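(* Let $\{f_k\}_{k=1}^M$ be a $\nu$-non-degenerate IFS, $f_k(x)=r_kA_kx+z_k$, that satisfies the open set condition and has similarity dimension $1$. Let $H$ be the attractor of $\{f_k\}_{k=1}^M$, let $a$ and $b$ denote the Ahlfors lower and upper constants of $H$, respectively, let $\tau$ denote the overlapping index of $\{f_k\}_{k=1}^M$, and set $K=\operatorname{conv}(H)$. There exists $\varepsilon_0=\varepsilon_0(r_1,\ldots,r_M,M,a,b,\tau,K)\in(0,1)$ so that for any $\varepsilon\in(0,\varepsilon_0]$ there exists a Lipschitz graph $\Gamma$ for which $$\dim(H\cap\Gamma)\ge 1-\varepsilon$$ and $$\operatorname{Lip}(\Gamma)\le\frac{\operatorname{diam}(K)}{\prod_{k=1}^M r_k}\max\left\{\frac1\nu,1\right\}\exp\left[20M\,\varepsilon^{-1}\log(\varepsilon^{-1})\right].$$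
   Context: $\dim$ denotes Hausdorff dimension, $\mathcal{H}^1$ the $1$-dimensional Hausdorff measure, $\operatorname{conv}$ the convex hull, and $|\cdot|$ Lebesgue measure on $\mathbb{R}$. For an angle $\theta$, $P_\theta(x,y)=x\cos\theta+y\sin\theta$; $\mathbb{S}^1$ is identified with the set of angles. An iterated function system (IFS) is a finite family $\{f_k\}_{k=1}^M$ of maps $f_k:\mathbb{R}^2\to\mathbb{R}^2$, $f_k(x)=r_kA_kx+z_k$, with $r_k\in(0,1)$, $A_k\in O(2)$ a rotation matrix, $z_k\in\mathbb{R}^2$, ordered so that $0<r_1\le\cdots\le r_M<1$. Its attractor is the unique nonempty compact $H$ with $H=\bigcup_k f_k(H)$. Its similarity dimension is the unique $s>0$ with $\sum_k r_k^s=1$. It satisfies the open set condition if there is a nonempty open $U\subseteq\mathbb{R}^2$ with $\bigcup_k f_k(U)\subseteq U$ and $f_i(U)\cap f_k(U)=\varnothing$ for $i\ne k$. It is $\nu$-non-degenerate if $\nu:=\inf\{|P_\theta(\operatorname{conv}(H))|:\theta\in\mathbb{S}^1\}>0$. Under these hypotheses $H$ is $1$-Ahlfors regular: there are $a,b>0$ with $ar\le\mathcal{H}^1(H\cap B(x,r))\le br$ for all $x\in H$, $r\in(0,\operatorname{diam}(H))$; $a$ and $b$ are called the Ahlfors lower and upper constants. For $j^{(n)}=(j_1,\dots,j_n)\in\{1,\dots,M\}^n$ write $f_{j^{(n)}}=f_{j_1}\circ\cdots\circ f_{j_n}$ and $K_{j^{(n)}}=f_{j^{(n)}}(K)$. The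 overlapping index of the IFS is $\tau=M^p$, where $p\ge0$ is the smallest integer such that for every $n\in\mathbb{N}$ the index set $\{1,\dots,M\}^n$ can be partitioned into $M^p$ (possibly empty) subcollections within each of which the sets $K_{j^{(n)}}$ have pairwise disjoint interiors, each subcollection having exactly $M^{n-p}$ elements when $n\ge p$ (such $p$ exists under the open set condition). A Lipschitz graph is a set $\Gamma=\{t\,\tau_1+g(t)\,\tau_2:t\in A\}$ with $A\subseteq\mathbb{R}$, $g:A\to\mathbb{R}$ Lipschitz, $\tau_1=(\cos\theta,\sin\theta)$, $\tau_2=(-\sin\theta,\cos\theta)$ for some angle $\theta$; $\operatorname{Lip}(\Gamma)$ is the (smallest) Lipschitz constant of $g$. *)

theory Defs
  imports "HOL-Analysis.Analysis"
begin

text \<open>The \<open>s\<close>-th power of the diameter, with the conventions that the empty set contributes \<open>0\<close>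
  and that a nonempty set contributes \<open>1\<close> when \<open>s = 0\<close> (HOL has \<open>0 powr 0 = 0\<close>).\<close>

definition diam_pow :: "real \<Rightarrow> 'a::metric_space set \<Rightarrow> ennreal" where
  "diam_pow s U = (if U = {} then 0 else if s = 0 then 1 else ennreal (diameter U powr s))"

text \<open>Boundedness of the covering sets is required explicitly, since \<open>diameter\<close> is only
  meaningful for bounded sets. No normalizing constant is used.\<close>

definition hausdorff_premeasure :: "real \<Rightarrow> real \<Rightarrow> 'a::metric_space set \<Rightarrow> ennreal" where
  "hausdorff_premeasure s \<delta> E =
     (INF U\<in>{U :: nat \<Rightarrow> 'a set. E \<subseteq> (\<Union>i. U i) \<and> (\<forall>i. bounded (U i) \<and> diameter (U i) \<le> \<delta>)}.
        \<Sum>i. diam_pow s (U i))"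

definition hausdorff_measure :: "real \<Rightarrow> 'a::metric_space set \<Rightarrow> ennreal" where
  "hausdorff_measure s E = (SUP \<delta>\<in>{0<..}. hausdorff_premeasure s \<delta> E)"

definition hausdorff_dim :: "'a::metric_space set \<Rightarrow> ereal" where
  "hausdorff_dim E = Inf {ereal s | s. 0 \<le> s \<and> hausdorff_measure s E = 0}"

definition ahlfors_regular_1 :: "real \<Rightarrow> real \<Rightarrow> 'a::metric_space set \<Rightarrow> bool" where
  "ahlfors_regular_1 a b H \<longleftrightarrow> 0 < a \<and> 0 < b \<and>
     (\<forall>x\<in>H. \<forall>\<rho>\<in>{0<..<diameter H}.
        ennreal (a * \<rho>) \<le> hausdorff_measure 1 (H \<inter> ball x \<rho>) \<and>
        hausdorff_measure 1 (H \<inter> ball x \<rho>) \<le> ennreal (b * \<rho>))"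

definition ifs_map :: "(nat \<Rightarrow> real) \<Rightarrow> (nat \<Rightarrow> real^2^2) \<Rightarrow> (nat \<Rightarrow> real^2) \<Rightarrow> nat \<Rightarrow> real^2 \<Rightarrow> real^2" where
  "ifs_map r A z k x = r k *\<^sub>R (A k *v x) + z k"

text \<open>The maps are indexed by \<open>{1..M}\<close>; the values of \<open>r\<close>, \<open>A\<close>, \<open>z\<close> at other indices are irrelevant.\<close>

definition is_ifs :: "nat \<Rightarrow> (nat \<Rightarrow> real) \<Rightarrow> (nat \<Rightarrow> real^2^2) \<Rightarrow> (nat \<Rightarrow> real^2) \<Rightarrow> bool" where
  "is_ifs M r A z \<longleftrightarrow>
     (\<forall>k\<in>{1..M}. 0 < r k \<and> r k < 1 \<and> orthogonal_matrix (A k)) \<and>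
     (\<forall>i\<in>{1..M}. \<forall>k\<in>{1..M}. i \<le> k \<longrightarrow> r i \<le> r k)"

definition is_attractor :: "nat \<Rightarrow> (nat \<Rightarrow> real^2 \<Rightarrow> real^2) \<Rightarrow> (real^2) set \<Rightarrow> bool" where
  "is_attractor M f H \<longleftrightarrow> H \<noteq> {} \<and> compact H \<and> H = (\<Union>k\<in>{1..M}. f k ` H)"

definition is_similarity_dimension :: "nat \<Rightarrow> (nat \<Rightarrow> real) \<Rightarrow> real \<Rightarrow> bool" where
  "is_similarity_dimension M r s \<longleftrightarrow> 0 < s \<and> (\<Sum>k\<in>{1..M}. r k powr s) = 1"

definition open_set_condition :: "nat \<Rightarrow> (nat \<Rightarrow> real^2 \<Rightarrow> real^2) \<Rightarrow> bool" where
  "open_set_condition M f \<longleftrightarrow>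
     (\<exists>U. open U \<and> U \<noteq> {} \<and> (\<Union>k\<in>{1..M}. f k ` U) \<subseteq> U \<and>
        (\<forall>i\<in>{1..M}. \<forall>k\<in>{1..M}. i \<noteq> k \<longrightarrow> f i ` U \<inter> f k ` U = {}))"

definition angle_proj :: "real \<Rightarrow> real^2 \<Rightarrow> real" where
  "angle_proj \<theta> x = x $ 1 * cos \<theta> + x $ 2 * sin \<theta>"

definition min_width :: "(real^2) set \<Rightarrow> real" where
  "min_width K = (INF \<theta>. measure lebesgue (angle_proj \<theta> ` K))"

definition nondegenerate :: "real \<Rightarrow> (real^2) set \<Rightarrow> bool" where
  "nondegenerate \<nu> H \<longleftrightarrow> \<nu> = min_width (convex hull H) \<and> 0 < \<nu>"

definition words :: "nat \<Rightarrow> nat \<Rightarrow> nat list set" where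
  "words M n = {w. length w = n \<and> set w \<subseteq> {1..M}}"

definition word_map :: "(nat \<Rightarrow> real^2 \<Rightarrow> real^2) \<Rightarrow> nat list \<Rightarrow> real^2 \<Rightarrow> real^2" where
  "word_map f w = foldr (\<lambda>k g. f k \<circ> g) w id"

definition overlap_exponent :: "nat \<Rightarrow> (nat \<Rightarrow> real^2 \<Rightarrow> real^2) \<Rightarrow> (real^2) set \<Rightarrow> nat \<Rightarrow> bool" where
  "overlap_exponent M f K p \<longleftrightarrow>
     (\<forall>n. \<exists>C :: nat \<Rightarrow> nat list set.
        disjoint_family_on C {..<M ^ p} \<and> (\<Union>q<M ^ p. C q) = words M n \<and>
        (\<forall>q<M ^ p. \<forall>i\<in>C q. \<forall>j\<in>C q. i \<noteq> j \<longrightarrow>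
           interior (word_map f i ` K) \<inter> interior (word_map f j ` K) = {}) \<and>
        (p \<le> n \<longrightarrow> (\<forall>q<M ^ p. card (C q) = M ^ (n - p))))"

definition overlapping_index :: "nat \<Rightarrow> (nat \<Rightarrow> real^2 \<Rightarrow> real^2) \<Rightarrow> (real^2) set \<Rightarrow> nat" where
  "overlapping_index M f K = M ^ (LEAST p. overlap_exponent M f K p)"

text \<open>One set may be a graph over several directions, with different functions, so \<open>\<theta>\<close>, \<open>T\<close>, \<open>g\<close>
  are kept as parameters; the Lipschitz constant of the graph is that of \<open>g\<close>.\<close>

definition is_lipschitz_graph :: "(real^2) set \<Rightarrow> real \<Rightarrow> real set \<Rightarrow> (real \<Rightarrow> real) \<Rightarrow> bool" where
  "is_lipschitz_graph \<Gamma> \<theta> T g \<longleftrightarrow>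
     \<Gamma> = (\<lambda>t. t *\<^sub>R vector [cos \<theta>, sin \<theta>] + g t *\<^sub>R vector [- sin \<theta>, cos \<theta>]) ` T \<and>
     (\<exists>L. L-lipschitz_on T g)"

definition lip_const :: "(real \<Rightarrow> real) \<Rightarrow> real set \<Rightarrow> real" where
  "lip_const g T = Inf {L. L-lipschitz_on T g}"

end

theory Submission
  imports Defs
begin

text \<open>
The graph is the limit set of a Moran construction inside \<open>H\<close>. Suppose that at each stage every
piece is replaced by smaller copies of \<open>H\<close>, all with the same contraction ratio \<open>\<rho>\<close>, whose
projections in a fixed direction \<open>\<theta>\<close> have gaps at least as large as the diameters of these copies. Two
points of the limit set that get separated at some stage then satisfy
\<open>dist x y \<le> (1/\<rho>) * \<bar>P x - P y\<bar>\<close> for the projection \<open>P\<close> in direction \<open>\<theta>\<close>, so the limit set is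
a Lipschitz graph with constant \<open>1/\<rho>\<close> (\<open>limit_set_cone\<close>). If the first \<open>k\<close> stages offer together
at least \<open>\<rho> powr -((1 - \<epsilon>) k)\<close> choices for every \<open>k\<close>, its dimension is at least \<open>1 - \<epsilon>\<close>
(\<open>hausdorff_dim_limit_set\<close>). It remains to find about \<open>\<rho> powr -(1 - \<epsilon>)\<close> pieces with separated
projections, in most of the directions that occur, for a \<open>\<rho>\<close> that is not too small.

The words whose ratio has just dropped to a given size have total ratio 1, so there are about \<open>1/\<rho>\<close> of them.
Because plane rotations commute, their linear parts take only polynomially many values in \<open>log (1/\<rho>)\<close>
(\<open>exists_class_of_equal_motions\<close>); the heaviest class with a common linear part still has \<open>1/\<rho>\<close>
members up to such a polynomial factor. Subadditivity of the Hausdorff measure and upper regularity show that at most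
a constant times \<open>t/\<rho>\<close> pieces lie within \<open>t * diameter H\<close> of a given one
(\<open>card_pieces_near_point\<close>). Two pieces at distance \<open>u\<close> have overlapping projections for a proportion
of order \<open>\<rho>/u\<close> of the directions, so summing over dyadic distances shows that, averaged over
directions, a piece overlaps with only \<open>log (1/\<rho>)\<close> others
(\<open>grid_sum_overlap_average_le\<close>). In a direction with few overlaps, a constant fraction of the class
divided by the mean overlap can be selected with separated projections
(\<open>exists_separated_subset\<close>).

A copy inside a copy sees the direction \<open>\<theta>\<close> moved by the common linear part. So the directions that occur form an
orbit of one isometry of the circle, and an initial direction is needed for which the overlap stays small in
the mean along the whole orbit. A maximal ergodic argument provides it
(\<open>exists_orbit_with_bounded_averages\<close>). All losses are polynomial in \<open>log (1/\<rho>)\<close> and must be paid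
for by \<open>\<rho> powr -\<epsilon>\<close>, which happens when \<open>log (1/\<rho>)\<close> is a suitable multiple of
\<open>M * (1/\<epsilon>) * log (1/\<epsilon>)\<close> (\<open>scale_parameters_exist\<close>); this is the exponent in the Lipschitz bound.
\<close>



section \<open>Hausdorff measure as an outer measure\<close>

lemma hausdorff_premeasure_mono:
  assumes "E \<subseteq> F" shows "hausdorff_premeasure s \<delta> E \<le> hausdorff_premeasure s \<delta> F"
  unfolding hausdorff_premeasure_def using assms by (intro INF_superset_mono) auto

lemma hausdorff_measure_mono:
  assumes "E \<subseteq> F" shows "hausdorff_measure s E \<le> hausdorff_measure s F"
  unfolding hausdorff_measure_def
  using hausdorff_premeasure_mono[OF assms] by (intro SUP_mono) auto

lemma hausdorff_premeasure_le_measure: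
  "0 < \<delta> \<Longrightarrow> hausdorff_premeasure s \<delta> E \<le> hausdorff_measure s E"
  unfolding hausdorff_measure_def by (intro SUP_upper) auto

lemma hausdorff_premeasure_Un_le:
  assumes "0 \<le> \<delta>"
  shows "hausdorff_premeasure s \<delta> (A \<union> B) \<le> hausdorff_premeasure s \<delta> A + hausdorff_premeasure s \<delta> B"
proof -
  have key: "hausdorff_premeasure s \<delta> (A \<union> B) \<le> (\<Sum>i. diam_pow s (U i)) + (\<Sum>i. diam_pow s (V i))"
    if U: "A \<subseteq> (\<Union>i. U i) \<and> (\<forall>i. bounded (U i) \<and> diameter (U i) \<le> \<delta>)"
      and V: "B \<subseteq> (\<Union>i. V i) \<and> (\<forall>i. bounded (V i) \<and> diameter (V i) \<le> \<delta>)"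
    for U V :: "nat \<Rightarrow> 'a set"
  proof -
    define W where "W = (\<lambda>(k::nat, i::nat). if k = 0 then U i else if k = 1 then V i else {})"
    have "(\<Sum>i. diam_pow s ((W \<circ> prod_decode) i)) = (\<Sum>k. \<Sum>i. diam_pow s (W (k, i)))"
      using suminf_ennreal_2dimen[of "\<lambda>k. \<Sum>i. diam_pow s (W (k, i))" "\<lambda>p. diam_pow s (W p)"]
      by (simp add: comp_def)
    also have "\<dots> = (\<Sum>k\<in>{0,1}. \<Sum>i. diam_pow s (W (k, i)))"
      by (rule suminf_finite) (auto simp: W_def diam_pow_def)
    also have "\<dots> = (\<Sum>i. diam_pow s (U i)) + (\<Sum>i. diam_pow s (V i))"
      by (simp add: W_def)
    finally have sum: "(\<Sum>i. diam_pow s ((W \<circ> prod_decode) i))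
      = (\<Sum>i. diam_pow s (U i)) + (\<Sum>i. diam_pow s (V i))" .
    have "x \<in> (\<Union>i. (W \<circ> prod_decode) i)" if x: "x \<in> A \<union> B" for x
    proof -
      consider i where "x \<in> U i" | i where "x \<in> V i" using x U V by blast
      then show ?thesis
      proof cases
        case (1 i)
        then have "x \<in> (W \<circ> prod_decode) (prod_encode (0, i))" by (simp add: W_def)
        then show ?thesis by blast
      next
        case (2 i)
        then have "x \<in> (W \<circ> prod_decode) (prod_encode (1, i))" by (simp add: W_def)
        then show ?thesis by blast
      qed
    qed
    moreover have "bounded ((W \<circ> prod_decode) i) \<and> diameter ((W \<circ> prod_decode) i) \<le> \<delta>" for i
      using U V assms by (auto simp: W_def split: prod.split)
    ultimately have "hausdorff_premeasure s \<delta> (A \<union> B) \<le> (\<Sum>i. diam_pow s ((W \<circ> prod_decode) i))"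
      unfolding hausdorff_premeasure_def by (intro INF_lower) auto
    then show ?thesis using sum by simp
  qed
  show ?thesis
  proof (rule ennreal_le_epsilon)
    fix e :: real assume e: "hausdorff_premeasure s \<delta> A + hausdorff_premeasure s \<delta> B < top" "0 < e"
    have fA: "hausdorff_premeasure s \<delta> A < hausdorff_premeasure s \<delta> A + ennreal (e/2)"
     and fB: "hausdorff_premeasure s \<delta> B < hausdorff_premeasure s \<delta> B + ennreal (e/2)"
      using e by (auto simp: less_top[symmetric] ennreal_add_left_cancel_less[of _ 0, simplified])
    obtain U where U: "A \<subseteq> (\<Union>i. U i) \<and> (\<forall>i. bounded (U i) \<and> diameter (U i) \<le> \<delta>)"
      "(\<Sum>i. diam_pow s (U i)) < hausdorff_premeasure s \<delta> A + ennreal (e/2)"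
      using fA unfolding hausdorff_premeasure_def[of s \<delta> A] INF_less_iff by blast
    obtain V where V: "B \<subseteq> (\<Union>i. V i) \<and> (\<forall>i. bounded (V i) \<and> diameter (V i) \<le> \<delta>)"
      "(\<Sum>i. diam_pow s (V i)) < hausdorff_premeasure s \<delta> B + ennreal (e/2)"
      using fB unfolding hausdorff_premeasure_def[of s \<delta> B] INF_less_iff by blast
    have "hausdorff_premeasure s \<delta> (A \<union> B)
       \<le> (hausdorff_premeasure s \<delta> A + ennreal (e/2)) + (hausdorff_premeasure s \<delta> B + ennreal (e/2))"
      using key[OF U(1) V(1)] U(2) V(2) by (meson add_mono less_imp_le order_trans)
    also have "\<dots> = hausdorff_premeasure s \<delta> A + hausdorff_premeasure s \<delta> B + (ennreal (e/2) + ennreal (e/2))"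
      by (simp add: ac_simps)
    also have "ennreal (e/2) + ennreal (e/2) = ennreal e"
      using e(2) by (simp flip: ennreal_plus)
    finally show "hausdorff_premeasure s \<delta> (A \<union> B)
      \<le> hausdorff_premeasure s \<delta> A + hausdorff_premeasure s \<delta> B + ennreal e" .
  qed
qed

lemma hausdorff_measure_Un_le:
  "hausdorff_measure s (A \<union> B) \<le> hausdorff_measure s A + hausdorff_measure s B"
proof -
  have "hausdorff_premeasure s \<delta> (A \<union> B) \<le> hausdorff_measure s A + hausdorff_measure s B" if "\<delta> > 0" for \<delta>
    using hausdorff_premeasure_Un_le[of \<delta> s A B] hausdorff_premeasure_le_measure[OF that] that
    by (meson add_mono less_imp_le order_trans)
  then show ?thesis
    unfolding hausdorff_measure_def[of s "A \<union> B"] by (intro SUP_least) auto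
qed

lemma hausdorff_measure_empty: "hausdorff_measure s {} = 0"
proof -
  have "hausdorff_premeasure s \<delta> ({} :: 'a set) = 0" if "\<delta> > 0" for \<delta>
  proof -
    have "hausdorff_premeasure s \<delta> ({} :: 'a set) \<le> (\<Sum>i::nat. diam_pow s ({} :: 'a set))"
      unfolding hausdorff_premeasure_def using that by (intro INF_lower) auto
    then show ?thesis by (simp add: diam_pow_def)
  qed
  then show ?thesis unfolding hausdorff_measure_def by (simp add: SUP_eq_const)
qed

text \<open>Together with monotonicity and scaling, this is what the counting of pieces of \<open>H\<close> rests on.\<close>

lemma hausdorff_measure_UN_le:
  assumes "finite I"
  shows "hausdorff_measure s (\<Union>i\<in>I. A i) \<le> (\<Sum>i\<in>I. hausdorff_measure s (A i))"
  using assms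
proof (induction I rule: finite_induct)
  case empty
  then show ?case by (simp add: hausdorff_measure_empty)
next
  case (insert x F)
  have "hausdorff_measure s (\<Union>i\<in>insert x F. A i)
      \<le> hausdorff_measure s (A x) + hausdorff_measure s (\<Union>i\<in>F. A i)"
    using hausdorff_measure_Un_le[of s "A x" "\<Union>i\<in>F. A i"] by simp
  also have "\<dots> \<le> hausdorff_measure s (A x) + (\<Sum>i\<in>F. hausdorff_measure s (A i))"
    using insert.IH by (intro add_left_mono)
  finally show ?case using insert.hyps by simp
qed

lemma bounded_lipschitz_image:
  fixes g :: "'a::metric_space \<Rightarrow> 'b::real_normed_vector"
  assumes g: "\<And>x y. dist (g x) (g y) \<le> \<rho> * dist x y" and U: "bounded U" and "0 \<le> \<rho>"
  shows "bounded (g ` U) \<and> diameter (g ` U) \<le> \<rho> * diameter U"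
proof -
  have *: "dist (g x) (g y) \<le> \<rho> * diameter U" if "x \<in> U" "y \<in> U" for x y
    using g[of x y] diameter_bounded_bound[OF U that] \<open>0 \<le> \<rho>\<close>
    by (meson mult_left_mono order_trans)
  have "bounded (g ` U)"
  proof (cases "U = {}")
    case False
    then obtain x where "x \<in> U" by blast
    then show ?thesis unfolding bounded_def
      by (intro exI[of _ "g x"] exI[of _ "\<rho> * diameter U"]) (auto simp: *)
  qed simp
  moreover have "diameter (g ` U) \<le> \<rho> * diameter U"
    by (rule diameter_le) (use * \<open>0 \<le> \<rho>\<close> diameter_ge_0[OF U] in \<open>auto simp: dist_norm\<close>)
  ultimately show ?thesis by blast
qed

lemma hausdorff_measure_1_lipschitz_image:
  fixes g :: "'a::metric_space \<Rightarrow> 'b::real_normed_vector"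
  assumes g: "\<And>x y. dist (g x) (g y) \<le> \<rho> * dist x y" and "0 < \<rho>"
  shows "hausdorff_measure 1 (g ` X) \<le> ennreal \<rho> * hausdorff_measure 1 X"
proof -
  have "hausdorff_premeasure 1 \<delta> (g ` X) \<le> ennreal \<rho> * hausdorff_measure 1 X" if "\<delta> > 0" for \<delta>
  proof -
    have "hausdorff_premeasure 1 \<delta> (g ` X) \<le> ennreal \<rho> * (\<Sum>i. diam_pow 1 (U i))"
      if U: "X \<subseteq> (\<Union>i. U i) \<and> (\<forall>i. bounded (U i) \<and> diameter (U i) \<le> \<delta> / \<rho>)" for U :: "nat \<Rightarrow> 'a set"
    proof -
      have b: "bounded (g ` U i) \<and> diameter (g ` U i) \<le> \<rho> * diameter (U i)" for i
        using bounded_lipschitz_image[OF g, of "U i"] U \<open>0 < \<rho>\<close> by auto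
      have "hausdorff_premeasure 1 \<delta> (g ` X) \<le> (\<Sum>i. diam_pow 1 (g ` U i))"
        unfolding hausdorff_premeasure_def
      proof (intro INF_lower CollectI conjI allI)
        show "g ` X \<subseteq> (\<Union>i. g ` U i)" using U by blast
        fix i show "bounded (g ` U i)" using b by blast
        have "\<rho> * diameter (U i) \<le> \<rho> * (\<delta> / \<rho>)" using U \<open>0 < \<rho>\<close> by (intro mult_left_mono) auto
        then show "diameter (g ` U i) \<le> \<delta>" using b[of i] \<open>0 < \<rho>\<close> by simp
      qed
      also have "\<dots> \<le> (\<Sum>i. ennreal \<rho> * diam_pow 1 (U i))"
      proof (intro suminf_le summableI)
        fix i
        have d: "0 \<le> diameter (U i)" "0 \<le> diameter (g ` U i)"
          using U b by (auto intro: diameter_ge_0)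
        show "diam_pow 1 (g ` U i) \<le> ennreal \<rho> * diam_pow 1 (U i)"
          using b[of i] d \<open>0 < \<rho>\<close> by (auto simp: diam_pow_def ennreal_mult[symmetric] intro: ennreal_leI)
      qed
      finally show ?thesis by simp
    qed
    then have "ennreal (1 / \<rho>) * hausdorff_premeasure 1 \<delta> (g ` X) \<le> ennreal (1 / \<rho>) * (ennreal \<rho> * (\<Sum>i. diam_pow 1 (U i)))"
      if "X \<subseteq> (\<Union>i. U i) \<and> (\<forall>i. bounded (U i) \<and> diameter (U i) \<le> \<delta> / \<rho>)" for U :: "nat \<Rightarrow> 'a set"
      using that by (intro mult_left_mono) auto
    moreover have cancel: "ennreal (1 / \<rho>) * (ennreal \<rho> * c) = c" "ennreal \<rho> * (ennreal (1 / \<rho>) * c) = c" for c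
      using \<open>0 < \<rho>\<close> by (simp_all flip: mult.assoc ennreal_mult)
    ultimately have "ennreal (1 / \<rho>) * hausdorff_premeasure 1 \<delta> (g ` X) \<le> hausdorff_premeasure 1 (\<delta> / \<rho>) X"
      unfolding hausdorff_premeasure_def[of 1 "\<delta> / \<rho>"] by (intro INF_greatest) auto
    also have "\<dots> \<le> hausdorff_measure 1 X"
      using that \<open>0 < \<rho>\<close> by (intro hausdorff_premeasure_le_measure) auto
    finally have "ennreal \<rho> * (ennreal (1 / \<rho>) * hausdorff_premeasure 1 \<delta> (g ` X)) \<le> ennreal \<rho> * hausdorff_measure 1 X"
      by (intro mult_left_mono) auto
    then show ?thesis unfolding cancel .
  qed
  then show ?thesis
    unfolding hausdorff_measure_def[of 1 "g ` X"] by (intro SUP_least) auto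
qed


section \<open>Projections onto lines and grids of directions\<close>

lemma angle_proj_diff: "angle_proj \<theta> (x - y) = angle_proj \<theta> x - angle_proj \<theta> y"
  by (simp add: angle_proj_def algebra_simps)

lemma angle_proj_polar:
  obtains \<beta> where "\<And>\<theta>. angle_proj \<theta> v = norm v * cos (\<theta> - \<beta>)"
proof (cases "v = 0")
  case True
  then show ?thesis using that[of 0] by (simp add: angle_proj_def)
next
  case False
  have n: "(norm v)\<^sup>2 = (v $ 1)\<^sup>2 + (v $ 2)\<^sup>2"
    by (simp add: norm_vec_def L2_set_def sum_2)
  have "(v $ 1 / norm v)\<^sup>2 + (v $ 2 / norm v)\<^sup>2 = 1"
    using False by (simp add: power_divide n[symmetric] flip: add_divide_distrib)
  then obtain \<beta> where "v $ 1 / norm v = cos \<beta>" "v $ 2 / norm v = sin \<beta>"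
    using sincos_total_2pi by metis
  then have "v $ 1 = norm v * cos \<beta>" "v $ 2 = norm v * sin \<beta>"
    using False by (simp_all add: field_simps)
  then show ?thesis using that[of \<beta>] by (simp add: angle_proj_def cos_diff algebra_simps)
qed

lemma abs_angle_proj_le: "\<bar>angle_proj \<theta> v\<bar> \<le> norm v"
proof -
  obtain \<beta> where "\<And>\<theta>. angle_proj \<theta> v = norm v * cos (\<theta> - \<beta>)" using angle_proj_polar[of v] by blast
  then show ?thesis by (simp add: abs_mult mult_left_le)
qed

lemma angle_proj_plus_pi: "angle_proj (\<theta> + pi) v = - angle_proj \<theta> v"
  by (simp add: angle_proj_def)

lemma norm_eq_angle_proj: "(norm v)\<^sup>2 = (angle_proj \<theta> v)\<^sup>2 + (angle_proj (\<theta> + pi/2) v)\<^sup>2"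
proof -
  obtain \<beta> where b: "\<And>\<theta>. angle_proj \<theta> v = norm v * cos (\<theta> - \<beta>)" using angle_proj_polar[of v] by blast
  have "cos (\<theta> + pi/2 - \<beta>) = - sin (\<theta> - \<beta>)"
    by (simp add: cos_add sin_add cos_diff sin_diff)
  then show ?thesis unfolding b
    by (simp add: power_mult_distrib flip: distrib_left)
qed

lemma angle_proj_decompose:
  "x = angle_proj \<theta> x *\<^sub>R vector [cos \<theta>, sin \<theta>] + angle_proj (\<theta> + pi/2) x *\<^sub>R vector [- sin \<theta>, cos \<theta>]"
proof -
  have "u = cos \<theta> * (cos \<theta> * u) + sin \<theta> * (sin \<theta> * u)" for u
    using sin_cos_squared_add2[of \<theta>] by (simp add: power2_eq_square flip: mult.assoc distrib_right)
  from this[of "x $ 1"] this[of "x $ 2"] show ?thesis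
    unfolding vec_eq_iff forall_2
    by (simp add: angle_proj_def cos_add sin_add algebra_simps)
qed

text \<open>With \<open>h = y/2\<close> one has \<open>sin y = 2 tan h cos\<^sup>2 h\<close>, where \<open>\<bar>tan h\<bar> \<ge> \<bar>h\<bar>\<close> and
\<open>cos\<^sup>2 h \<ge> 1/2\<close>.\<close>

lemma half_abs_le_abs_sin:
  assumes "\<bar>y\<bar> \<le> pi/2" shows "\<bar>y\<bar> / 2 \<le> \<bar>sin y\<bar>"
proof -
  define h where "h = y / 2"
  have h: "\<bar>h\<bar> \<le> pi/4" using assms by (simp add: h_def)
  then have "\<bar>h\<bar> < pi/2" using pi_gt_zero by linarith
  then have t: "\<bar>h\<bar> \<le> \<bar>tan h\<bar>" by (rule abs_tan_ge)
  have "cos (pi/4) \<le> cos \<bar>h\<bar>"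
    using h by (intro cos_monotone_0_pi_le) auto
  then have c: "sqrt 2 / 2 \<le> cos h" by (simp add: cos_45)
  then have c0: "cos h > 0" by (smt (verit) divide_pos_pos real_sqrt_gt_zero)
  have c2: "1/2 \<le> (cos h)\<^sup>2"
    using power_mono[OF c, of 2] by (simp add: power_divide)
  have "\<bar>sin y\<bar> = 2 * \<bar>sin h\<bar> * cos h"
    using c0 sin_double[of h] by (simp add: h_def abs_mult)
  also have "\<dots> = 2 * \<bar>tan h\<bar> * (cos h)\<^sup>2"
    using c0 by (simp add: tan_def power2_eq_square abs_divide)
  also have "\<dots> \<ge> 2 * \<bar>h\<bar> * (1/2)"
    using t c2 by (intro mult_mono) auto
  finally show ?thesis by (simp add: h_def)
qed

text \<open>If \<open>\<bar>cos\<bar> \<le> t\<close> at the \<open>j\<close>-th angle, then the angle lies within \<open>2 t\<close> of an odd multiple of \<open>pi/2\<close>.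
Rescaled by \<open>Q / pi\<close>, this puts the integer \<open>\<plusminus>j\<close> minus a multiple of \<open>Q\<close> into an interval of length at
most \<open>2 Q t\<close> that is the same for every \<open>j\<close>. These integers are distinct modulo \<open>Q\<close>, so there are at most \<open>2 Q t + 1\<close>
of them. The bound is uniform in the shift \<open>c\<close>, which lets sums over a grid replace an integral over
the circle: an isometry of the circle sends a grid to a grid of the same kind.\<close>

lemma card_grid_small_cos:
  fixes \<sigma> :: real
  assumes \<sigma>: "\<sigma> = 1 \<or> \<sigma> = -1" and Q: "0 < Q" and t: "0 \<le> t"
  shows "real (card {j. j < Q \<and> \<bar>cos (c + \<sigma> * pi * real j / real Q)\<bar> \<le> t}) \<le> 2 * real Q * t + 1"
    (is "real (card ?J) \<le> _")
proof -
  define \<sigma>' :: int where "\<sigma>' = (if \<sigma> = 1 then 1 else -1)"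
  have \<sigma>': "\<sigma> = of_int \<sigma>'" "\<sigma>' = 1 \<or> \<sigma>' = -1" using \<sigma> by (auto simp: \<sigma>'_def)
  define y where "y j = c + \<sigma> * pi * real j / real Q - pi/2" for j
  define m where "m j = round (y j / pi)" for j
  \<comment> \<open>the common centre of the interval that contains the integers \<open>g j\<close> below\<close>
  define a where "a = real Q * (1/2 - c / pi)"
  define g where "g j = \<sigma>' * int j - int Q * m j" for j
  have near: "\<bar>of_int (g j) - a\<bar> \<le> real Q * t" if j: "j \<in> ?J" for j
  proof -
    define z where "z = y j - pi * of_int (m j)"
    have "\<bar>y j / pi - of_int (m j)\<bar> \<le> 1/2"
      unfolding m_def using of_int_round_abs_le[of "y j / pi"] by (simp add: abs_minus_commute)
    moreover have "y j / pi - of_int (m j) = z / pi" by (simp add: z_def field_simps)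
    ultimately have z: "\<bar>z\<bar> \<le> pi/2" by (simp add: field_simps)
    have "\<bar>sin z\<bar> = \<bar>sin (y j)\<bar>"
      unfolding z_def sin_diff by (simp add: abs_mult cos_npi_int)
    also have "sin (y j) = - cos (c + \<sigma> * pi * real j / real Q)"
      unfolding y_def by (simp add: sin_diff)
    finally have "\<bar>sin z\<bar> \<le> t" using j by simp
    then have zt: "\<bar>z\<bar> \<le> 2 * t" using half_abs_le_abs_sin[OF z] by simp
    have "of_int (g j) - a = real Q / pi * z"
      using Q unfolding g_def a_def z_def y_def by (simp add: \<sigma>'(1) field_simps)
    then have "\<bar>of_int (g j) - a\<bar> = real Q * (\<bar>z\<bar> / pi)" by (simp add: abs_mult)
    also have "\<bar>z\<bar> / pi \<le> t"
    proof -
      have "\<bar>z\<bar> \<le> t * pi" using zt t pi_ge_two mult_left_mono[of 2 pi t] by linarith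
      then show ?thesis by (simp add: field_simps)
    qed
    finally show ?thesis by (simp add: mult_left_mono)
  qed
  have inj: "inj_on g ?J"
  proof (rule inj_onI)
    fix i j assume ij: "i \<in> ?J" "j \<in> ?J" "g i = g j"
    then have "\<sigma>' * (int i - int j) = int Q * (m i - m j)" by (simp add: g_def algebra_simps)
    then have "int Q dvd \<sigma>' * (int i - int j)" by simp
    then have "int Q dvd int i - int j" using \<sigma>'(2) by (auto simp: dvd_diff_commute)
    moreover have "\<bar>int i - int j\<bar> < int Q" using ij by auto
    ultimately show "i = j" using zdvd_not_zless[of "\<bar>int i - int j\<bar>" "int Q"] by (cases "int i - int j = 0") auto
  qed
  have "g ` ?J \<subseteq> {\<lceil>a - real Q * t\<rceil> .. \<lfloor>a + real Q * t\<rfloor>}"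
    using near by (fastforce simp: ceiling_le_iff le_floor_iff abs_le_iff)
  then have "card (g ` ?J) \<le> card {\<lceil>a - real Q * t\<rceil> .. \<lfloor>a + real Q * t\<rfloor>}"
    by (intro card_mono) auto
  then have "card ?J \<le> nat (\<lfloor>a + real Q * t\<rfloor> - \<lceil>a - real Q * t\<rceil> + 1)"
    using card_image[OF inj] by simp
  moreover have "real (nat (\<lfloor>a + real Q * t\<rfloor> - \<lceil>a - real Q * t\<rceil> + 1)) \<le> 2 * real Q * t + 1"
  proof (cases "\<lfloor>a + real Q * t\<rfloor> - \<lceil>a - real Q * t\<rceil> + 1 \<ge> 0")
    case True
    then show ?thesis by (simp add: of_nat_nat) linarith
  next
    case False
    then show ?thesis using t by simp
  qed
  ultimately show ?thesis by linarith
qed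

section \<open>Orbits with bounded ergodic averages\<close>

text \<open>A maximal ergodic argument for an isometry of the circle of directions. If every orbit had a time at
which its average exceeds \<open>L\<close>, then compactness would bound these times by some \<open>B\<close>. Every long orbit
could then be cut into blocks of length at most \<open>B\<close> with averages above \<open>L\<close>, so that all long averages would be
nearly at least \<open>L\<close>. But averaging over the orbits that start on a grid, whose images are again
grids, gives at most \<open>m < L\<close>.

The bound holds at every time \<open>k\<close> and not only at infinitely many; a lower bound for the Hausdorff
dimension requires this.\<close>

lemma exists_orbit_with_bounded_averages:
  fixes F :: "real \<Rightarrow> real" and T :: "real \<Rightarrow> real"
  assumes F: "continuous_on UNIV F" "\<And>\<theta>. 0 \<le> F \<theta>" "\<And>\<theta>. F (\<theta> + pi) = F \<theta>"
    and T: "T = (\<lambda>\<theta>. s * (\<theta> - \<alpha>))" and s: "s = 1 \<or> s = -1"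
    and grid: "\<And>c \<sigma>. \<sigma> = 1 \<or> \<sigma> = -1 \<Longrightarrow> (\<Sum>j<Q. F (c + \<sigma> * pi * real j / real Q)) \<le> real Q * m"
    and Q: "0 < Q" and L: "m < L"
  shows "\<exists>\<theta>. \<forall>k. (\<Sum>i<k. F ((T ^^ i) \<theta>)) \<le> real k * L"
proof (rule ccontr)
  define S where "S k \<theta> = (\<Sum>i<k. F ((T ^^ i) \<theta>))" for k \<theta>
  assume "\<nexists>\<theta>. \<forall>k. (\<Sum>i<k. F ((T ^^ i) \<theta>)) \<le> real k * L"
  then have ex: "\<exists>k. real k * L < S k \<theta>" for \<theta> by (auto simp: S_def not_le)
  have "0 \<le> real Q * m"
    using grid[of 1 0] sum_nonneg[of "{..<Q}" "\<lambda>j. F (0 + 1 * pi * real j / real Q)"] F(2)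
    by (meson order_trans)
  then have L0: "0 < L" using Q L by (simp add: zero_le_mult_iff)
  have affine: "\<exists>\<sigma> c. (\<sigma> = 1 \<or> \<sigma> = -1) \<and> (\<forall>\<theta>. (T ^^ i) \<theta> = c + \<sigma> * \<theta>)" for i
  proof (induction i)
    case 0
    show ?case by (intro exI[of _ 1] exI[of _ 0]) auto
  next
    case (Suc i)
    then obtain \<sigma> c where "\<sigma> = 1 \<or> \<sigma> = -1" "\<forall>\<theta>. (T ^^ i) \<theta> = c + \<sigma> * \<theta>" by blast
    then show ?case using s
      by (intro exI[of _ "s * \<sigma>"] exI[of _ "s * (c - \<alpha>)"]) (auto simp: T algebra_simps)
  qed
  have Fper: "F (\<theta> - pi) = F \<theta>" for \<theta> using F(3)[of "\<theta> - pi"] by simp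
  have Sper: "S k (\<theta> + pi) = S k \<theta>" for k \<theta>
    unfolding S_def
  proof (rule sum.cong)
    fix i
    obtain \<sigma> c where "\<sigma> = 1 \<or> \<sigma> = -1" "\<forall>\<theta>. (T ^^ i) \<theta> = c + \<sigma> * \<theta>" using affine by blast
    then show "F ((T ^^ i) (\<theta> + pi)) = F ((T ^^ i) \<theta>)"
      using F(3)[of "c + \<theta>"] Fper[of "c - \<theta>"] by (auto simp: algebra_simps)
  qed simp
  have Sper_int: "S k (\<theta> + of_int n * pi) = S k \<theta>" for k \<theta> n
  proof (induction n rule: int_induct[where k = 0])
    case (step1 i)
    then show ?case using Sper[of k "\<theta> + of_int i * pi"] by (simp add: algebra_simps)
  next
    case (step2 i)
    then show ?case using Sper[of k "\<theta> + of_int i * pi - pi"] by (simp add: algebra_simps)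
  qed simp
  have Tcont: "continuous_on UNIV (T ^^ i)" for i
  proof -
    obtain \<sigma> c where "\<forall>\<theta>. (T ^^ i) \<theta> = c + \<sigma> * \<theta>" using affine by blast
    then have "T ^^ i = (\<lambda>\<theta>. c + \<sigma> * \<theta>)" by auto
    then show ?thesis by (auto intro: continuous_intros)
  qed
  have Scont: "continuous_on UNIV (S k)" for k
    unfolding S_def using Tcont by (intro continuous_intros continuous_on_compose2[OF F(1)]) auto
  have op: "open {\<theta>. real k * L < S k \<theta>}" for k
    using Scont[of k] by (intro open_Collect_less continuous_intros) auto
  have cov: "{0..pi} \<subseteq> (\<Union>k. {\<theta>. real k * L < S k \<theta>})" using ex by auto
  obtain C where C: "finite C" "{0..pi} \<subseteq> (\<Union>k\<in>C. {\<theta>. real k * L < S k \<theta>})"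
  proof (rule compactE_image[OF compact_Icc _ cov])
    show "open {\<theta>. real k * L < S k \<theta>}" for k by (rule op)
  qed auto
  define B where "B = Max (insert 0 C)"
  have bnd: "\<exists>k\<le>B. real k * L < S k \<theta>" for \<theta>
  proof -
    define n where "n = \<lfloor>\<theta> / pi\<rfloor>"
    have "\<theta> + of_int (- n) * pi \<in> {0..pi}"
      using floor_divide_lower[OF pi_gt_zero, of \<theta>] floor_divide_upper[OF pi_gt_zero, of \<theta>]
      by (simp add: n_def algebra_simps)
    then obtain k where "k \<in> C" "real k * L < S k (\<theta> + of_int (- n) * pi)" using C by blast
    then show ?thesis using C(1) unfolding Sper_int by (auto simp: B_def intro!: exI[of _ k] Max_ge)
  qed
  have Snn: "0 \<le> S k \<theta>" for k \<theta> unfolding S_def by (intro sum_nonneg F(2))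
  have Sadd: "S (k + n) \<theta> = S k \<theta> + S n ((T ^^ k) \<theta>)" for k n \<theta>
  proof -
    have "S (k + n) \<theta> = S k \<theta> + (\<Sum>i<n. F ((T ^^ (i + k)) \<theta>))"
      unfolding S_def
      by (induction n) (auto simp: add.commute)
    then show ?thesis by (simp add: S_def funpow_add)
  qed
  \<comment> \<open>Cut an orbit segment into blocks of length at most \<open>B\<close> with average above \<open>L\<close>;
    an incomplete last block costs at most \<open>B * L\<close>, as \<open>F\<close> is nonnegative.\<close>
  have low: "(real n - real B) * L \<le> S n \<theta>" for n \<theta>
  proof (induction n arbitrary: \<theta> rule: less_induct)
    case (less n)
    show ?case
    proof (cases "n \<le> B")
      case True
      then have "(real n - real B) * L \<le> 0" using L0 by (simp add: mult_nonpos_nonneg)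
      then show ?thesis using Snn[of n \<theta>] by linarith
    next
      case False
      obtain k where k: "k \<le> B" "real k * L < S k \<theta>" using bnd by blast
      have "k \<noteq> 0" using k(2) by (auto simp: S_def intro: ccontr)
      then have IH: "(real (n - k) - real B) * L \<le> S (n - k) ((T ^^ k) \<theta>)"
        using False k(1) by (intro less.IH) auto
      have "S n \<theta> = S k \<theta> + S (n - k) ((T ^^ k) \<theta>)"
        using Sadd[of k "n - k" \<theta>] False k(1) by simp
      moreover have "(real n - real B) * L = real k * L + (real (n - k) - real B) * L"
        using False k(1) by (simp add: of_nat_diff algebra_simps)
      ultimately show ?thesis using IH k(2) by linarith
    qed
  qed
  have up: "(\<Sum>j<Q. S n (pi * real j / real Q)) \<le> real n * (real Q * m)" for n
  proof -
    have "(\<Sum>j<Q. S n (pi * real j / real Q)) = (\<Sum>i<n. \<Sum>j<Q. F ((T ^^ i) (pi * real j / real Q)))"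
      unfolding S_def by (rule sum.swap)
    also have "\<dots> \<le> (\<Sum>i<n. real Q * m)"
    proof (rule sum_mono)
      fix i
      obtain \<sigma> c where sc: "\<sigma> = 1 \<or> \<sigma> = -1" "\<forall>\<theta>. (T ^^ i) \<theta> = c + \<sigma> * \<theta>" using affine by blast
      then show "(\<Sum>j<Q. F ((T ^^ i) (pi * real j / real Q))) \<le> real Q * m"
        using grid[OF sc(1), of c] by (simp add: mult.assoc)
    qed
    finally show ?thesis by simp
  qed
  have "real n * (L - m) \<le> real B * L" for n
  proof -
    have "real Q * ((real n - real B) * L) \<le> (\<Sum>j<Q. S n (pi * real j / real Q))"
      using sum_mono[of "{..<Q}" "\<lambda>_. (real n - real B) * L" "\<lambda>j. S n (pi * real j / real Q)"] low by simp
    also have "\<dots> \<le> real Q * (real n * m)" using up[of n] by (simp add: algebra_simps)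
    finally have "(real n - real B) * L \<le> real n * m" using Q by simp
    then show ?thesis by (simp add: algebra_simps)
  qed
  moreover obtain n :: nat where "real B * L < real n * (L - m)"
    using reals_Archimedean3[of "L - m"] L by auto
  ultimately show False by (meson not_le)
qed

section \<open>Independent sets in sparse graphs\<close>

text \<open>Here \<open>d\<close> bounds the average degree, loops included. At least half of the vertices have degree at most
\<open>2 d\<close>, and a maximal independent set among those dominates them.\<close>

lemma exists_independent_subset:
  assumes fin: "finite C" and sym: "\<And>x y. R x y \<Longrightarrow> R y x" and rfl: "\<And>x. x \<in> C \<Longrightarrow> R x x"
    and deg: "(\<Sum>x\<in>C. real (card {y\<in>C. R x y})) \<le> real (card C) * d" and d: "0 < d"
  shows "\<exists>S\<subseteq>C. (\<forall>x\<in>S. \<forall>y\<in>S. x \<noteq> y \<longrightarrow> \<not> R x y) \<and> real (card C) \<le> 4 * d * real (card S)"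
proof -
  define V where "V = {x\<in>C. real (card {y\<in>C. R x y}) \<le> 2 * d}"
  have V: "finite V" "V \<subseteq> C" using fin by (auto simp: V_def)
  have "real (card (C - V)) * (2 * d) = (\<Sum>x\<in>C - V. 2 * d)" by simp
  also have "\<dots> \<le> (\<Sum>x\<in>C - V. real (card {y\<in>C. R x y}))"
    by (rule sum_mono) (auto simp: V_def)
  also have "\<dots> \<le> (\<Sum>x\<in>C. real (card {y\<in>C. R x y}))"
    using fin by (intro sum_mono2) auto
  also have "\<dots> \<le> real (card C) * d" by (rule deg)
  finally have "2 * real (card (C - V)) \<le> real (card C)" using d by simp
  moreover have "card C = card (C - V) + card V"
    using V fin by (simp add: card_Diff_subset card_mono)
  ultimately have half: "real (card C) \<le> 2 * real (card V)" by linarith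
  define I where "I = {S. S \<subseteq> V \<and> (\<forall>x\<in>S. \<forall>y\<in>S. x \<noteq> y \<longrightarrow> \<not> R x y)}"
  have finI: "finite I" using V(1) by (auto simp: I_def)
  have "{} \<in> I" by (simp add: I_def)
  then have neI: "I \<noteq> {}" by blast
  obtain S where S: "S \<in> I" and mx: "\<And>S'. S' \<in> I \<Longrightarrow> S \<subseteq> S' \<Longrightarrow> S = S'"
    using finite_has_maximal[OF finI neI] by blast
  have SV: "S \<subseteq> V" and ind: "\<forall>x\<in>S. \<forall>y\<in>S. x \<noteq> y \<longrightarrow> \<not> R x y" using S by (auto simp: I_def)
  have "V \<subseteq> (\<Union>x\<in>S. {y\<in>C. R x y})"
  proof
    fix y assume y: "y \<in> V"
    show "y \<in> (\<Union>x\<in>S. {y\<in>C. R x y})"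
    proof (cases "y \<in> S")
      case True
      then show ?thesis using y V rfl by blast
    next
      case False
      then have "insert y S \<notin> I" using mx[of "insert y S"] by blast
      then obtain x where "x \<in> S" "R x y" using y SV ind sym by (auto simp: I_def)
      then show ?thesis using y V by blast
    qed
  qed
  then have "card V \<le> card (\<Union>x\<in>S. {y\<in>C. R x y})"
    using fin SV V by (intro card_mono) (auto intro: finite_subset)
  also have "\<dots> \<le> (\<Sum>x\<in>S. card {y\<in>C. R x y})"
    using finite_subset[OF SV V(1)] by (rule card_UN_le)
  finally have "real (card V) \<le> (\<Sum>x\<in>S. real (card {y\<in>C. R x y}))"
    by (metis of_nat_le_iff of_nat_sum)
  also have "\<dots> \<le> (\<Sum>x\<in>S. 2 * d)" using SV by (intro sum_mono) (auto simp: V_def)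
  finally have "real (card V) \<le> 2 * d * real (card S)" by (simp add: mult.commute)
  then have "real (card C) \<le> 4 * d * real (card S)" using half by linarith
  then show ?thesis using SV V ind by blast
qed


section \<open>Moran constructions with separated projections\<close>

text \<open>At stage \<open>i\<close> each piece is replaced by its images under the maps indexed by \<open>S i\<close>; all of them contract by the
same \<open>\<rho>\<close>. The functional that is relevant at stage \<open>i\<close> is \<open>P i\<close>, and a map of stage \<open>i\<close> turns \<open>P i\<close>
into \<open>\<rho>\<close> times \<open>P (i + 1)\<close>: in the application these are projections in the directions that the rotations of
the maps produce from one initial direction. The gap required in \<open>separated\<close> equals the bound \<open>\<rho> * D\<close> on the size of the
pieces.\<close>

locale moran_construction =
  fixes S :: "nat \<Rightarrow> 'i set" and f :: "'i \<Rightarrow> 'a::heine_borel \<Rightarrow> 'a" and H :: "'a set"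
    and P :: "nat \<Rightarrow> 'a \<Rightarrow> real" and \<rho> D :: real
  assumes finite_S: "finite (S i)" and S_ne: "S i \<noteq> {}"
    and compact_H: "compact H" and H_ne: "H \<noteq> {}"
    and dist_H: "\<lbrakk>x \<in> H; y \<in> H\<rbrakk> \<Longrightarrow> dist x y \<le> D"
    and f_H: "w \<in> S i \<Longrightarrow> f w ` H \<subseteq> H"
    and dist_f: "w \<in> S i \<Longrightarrow> dist (f w x) (f w y) = \<rho> * dist x y"
    and P_f: "w \<in> S i \<Longrightarrow> P i (f w x) - P i (f w y) = \<rho> * (P (Suc i) x - P (Suc i) y)"
    and separated: "\<lbrakk>w \<in> S i; w' \<in> S i; w \<noteq> w'; x \<in> H; y \<in> H\<rbrakk>
       \<Longrightarrow> \<rho> * D \<le> \<bar>P i (f w x) - P i (f w' y)\<bar>"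
    and P_0: "\<bar>P 0 x - P 0 y\<bar> \<le> dist x y"
    and \<rho>: "0 < \<rho>" "\<rho> < 1" and D: "0 < D"
begin

text \<open>The offset \<open>i\<close> is the stage at which the address starts; it makes the tails of addresses
addresses again, as induction on the length needs.\<close>

definition addresses :: "nat \<Rightarrow> nat \<Rightarrow> 'i list set" where
  "addresses i k = {ws. length ws = k \<and> (\<forall>l<k. ws ! l \<in> S (i + l))}"

definition cylinder :: "'i list \<Rightarrow> 'a set" where
  "cylinder ws = foldr (\<lambda>w g. f w \<circ> g) ws id ` H"

definition limit_set :: "'a set" where
  "limit_set = (\<Inter>k. \<Union>ws\<in>addresses 0 k. cylinder ws)"

lemma addresses_0: "addresses i 0 = {[]}"
  by (auto simp: addresses_def)

lemma Cons_in_addresses: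
  "w # ws \<in> addresses i (Suc k) \<longleftrightarrow> w \<in> S i \<and> ws \<in> addresses (Suc i) k"
  by (auto simp: addresses_def nth_Cons split: nat.splits)

lemma addresses_Suc: "addresses i (Suc k) = (\<Union>w\<in>S i. (#) w ` addresses (Suc i) k)"
proof (intro equalityI subsetI)
  fix ws assume ws: "ws \<in> addresses i (Suc k)"
  then obtain w vs where "ws = w # vs" by (cases ws) (auto simp: addresses_def)
  then show "ws \<in> (\<Union>w\<in>S i. (#) w ` addresses (Suc i) k)" using ws by (auto simp: Cons_in_addresses)
qed (auto simp: Cons_in_addresses)

lemma finite_addresses: "finite (addresses i k)"
  by (induction k arbitrary: i) (auto simp: addresses_0 addresses_Suc finite_S)

lemma card_addresses: "card (addresses i k) = (\<Prod>l<k. card (S (i + l)))"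
proof (induction k arbitrary: i)
  case (Suc k)
  have "card (addresses i (Suc k)) = (\<Sum>w\<in>S i. card ((#) w ` addresses (Suc i) k))"
    unfolding addresses_Suc by (rule card_UN_disjoint) (auto simp: finite_S finite_addresses)
  also have "\<dots> = card (S i) * (\<Prod>l<k. card (S (Suc i + l)))"
    by (simp add: card_image Suc.IH)
  also have "\<dots> = (\<Prod>l<Suc k. card (S (i + l)))"
    unfolding prod.lessThan_Suc_shift by simp
  finally show ?case .
qed (simp add: addresses_0)

lemma card_addresses_pos: "0 < card (addresses i k)"
  unfolding card_addresses by (intro prod_pos) (auto simp: card_gt_0_iff finite_S S_ne)

lemma card_addresses_add:
  "card (addresses i (k + m)) = card (addresses i k) * card (addresses (i + k) m)"
proof -
  have "(\<Prod>l<k + m. card (S (i + l))) = (\<Prod>l<k. card (S (i + l))) * (\<Prod>l<m. card (S (i + k + l)))"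
    by (induction m) (simp_all add: add.assoc mult.assoc)
  then show ?thesis by (simp add: card_addresses)
qed

lemma take_in_addresses: "ws \<in> addresses i k \<Longrightarrow> j \<le> k \<Longrightarrow> take j ws \<in> addresses i j"
  by (auto simp: addresses_def)

lemma drop_in_addresses: "ws \<in> addresses i k \<Longrightarrow> j \<le> k \<Longrightarrow> drop j ws \<in> addresses (i + j) (k - j)"
  by (auto simp: addresses_def add.assoc)

lemma cylinder_Nil: "cylinder [] = H"
  by (simp add: cylinder_def)

lemma cylinder_Cons: "cylinder (w # ws) = f w ` cylinder ws"
  by (simp add: cylinder_def image_comp)

lemma cylinder_subset: "ws \<in> addresses i k \<Longrightarrow> cylinder ws \<subseteq> H"
proof (induction k arbitrary: i ws)
  case (Suc k)
  then obtain w vs where "ws = w # vs" "w \<in> S i" "vs \<in> addresses (Suc i) k"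
    by (auto simp: addresses_Suc)
  then show ?case using Suc.IH f_H by (fastforce simp: cylinder_Cons)
qed (simp add: addresses_0 cylinder_Nil)

lemma cylinder_ne: "cylinder ws \<noteq> {}"
  by (simp add: cylinder_def H_ne)

lemma compact_cylinder: "ws \<in> addresses i k \<Longrightarrow> compact (cylinder ws)"
proof (induction k arbitrary: i ws)
  case (Suc k)
  then obtain w vs where w: "ws = w # vs" "w \<in> S i" "vs \<in> addresses (Suc i) k"
    by (auto simp: addresses_Suc)
  have "\<rho>-lipschitz_on (cylinder vs) (f w)"
    by (rule lipschitz_onI) (use dist_f[OF w(2)] \<rho> in auto)
  then have "continuous_on (cylinder vs) (f w)" by (rule lipschitz_on_continuous_on)
  then show ?case using Suc.IH w by (auto simp: cylinder_Cons intro: compact_continuous_image)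
qed (simp add: addresses_0 cylinder_Nil compact_H)

lemma cylinder_take:
  "ws \<in> addresses i k \<Longrightarrow> j \<le> k \<Longrightarrow> cylinder ws \<subseteq> cylinder (take j ws)"
proof (induction k arbitrary: i j ws)
  case (Suc k)
  then obtain w vs where w: "ws = w # vs" "w \<in> S i" "vs \<in> addresses (Suc i) k"
    by (auto simp: addresses_Suc)
  show ?case
  proof (cases j)
    case 0
    then show ?thesis using cylinder_subset Suc.prems by (auto simp: cylinder_Nil)
  next
    case (Suc j')
    then show ?thesis using Suc.IH[OF w(3)] Suc.prems w by (auto simp: cylinder_Cons)
  qed
qed (simp add: addresses_0)

text \<open>The number \<open>j\<close> is the length of the longest common prefix: the two points still lie in one piece of
size \<open>\<rho> ^ j * D\<close>, and at the next stage their projections are separated.\<close>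

lemma cylinders_separated:
  "\<lbrakk>ws \<in> addresses i k; ws' \<in> addresses i k; ws \<noteq> ws'; x \<in> cylinder ws; y \<in> cylinder ws'\<rbrakk>
   \<Longrightarrow> \<exists>j<k. take j ws = take j ws' \<and> dist x y \<le> \<rho> ^ j * D \<and> \<rho> ^ Suc j * D \<le> \<bar>P i x - P i y\<bar>"
proof (induction k arbitrary: i ws ws' x y)
  case (Suc k)
  obtain w vs where w: "ws = w # vs" "w \<in> S i" "vs \<in> addresses (Suc i) k"
    using Suc.prems(1) by (auto simp: addresses_Suc)
  obtain w' vs' where w': "ws' = w' # vs'" "w' \<in> S i" "vs' \<in> addresses (Suc i) k"
    using Suc.prems(2) by (auto simp: addresses_Suc)
  obtain x0 where x0: "x0 \<in> cylinder vs" "x = f w x0" using Suc.prems w by (auto simp: cylinder_Cons)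
  obtain y0 where y0: "y0 \<in> cylinder vs'" "y = f w' y0" using Suc.prems w' by (auto simp: cylinder_Cons)
  show ?case
  proof (cases "w = w'")
    case False
    have "x0 \<in> H" "y0 \<in> H" using x0 y0 w w' cylinder_subset by blast+
    then have "\<rho> * D \<le> \<bar>P i x - P i y\<bar>"
      using separated[OF w(2) w'(2) False] x0 y0 by blast
    moreover have "dist x y \<le> D"
      using dist_H Suc.prems cylinder_subset by blast
    ultimately show ?thesis by (intro exI[of _ 0]) auto
  next
    case True
    then have "vs \<noteq> vs'" using Suc.prems(3) w w' by simp
    then obtain j where j: "j < k" "take j vs = take j vs'" "dist x0 y0 \<le> \<rho> ^ j * D"
      "\<rho> ^ Suc j * D \<le> \<bar>P (Suc i) x0 - P (Suc i) y0\<bar>"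
      using Suc.IH[OF w(3) w'(3) _ x0(1) y0(1)] by blast
    have "dist x y = \<rho> * dist x0 y0" using dist_f[OF w(2)] x0 y0 True by simp
    moreover have "\<bar>P i x - P i y\<bar> = \<rho> * \<bar>P (Suc i) x0 - P (Suc i) y0\<bar>"
      using P_f[OF w(2)] x0 y0 True \<rho> by (simp add: abs_mult)
    ultimately show ?thesis using j w w' True \<rho>
      by (intro exI[of _ "Suc j"]) (auto simp: mult.assoc)
  qed
qed (simp add: addresses_0)

lemma limit_set_address:
  assumes "x \<in> limit_set" obtains ws where "ws \<in> addresses 0 k" "x \<in> cylinder ws"
  using assms by (auto simp: limit_set_def)

lemma limit_set_subset: "limit_set \<subseteq> H"
proof
  fix x assume "x \<in> limit_set"
  then obtain ws where "ws \<in> addresses 0 0" "x \<in> cylinder ws" by (rule limit_set_address)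
  then show "x \<in> H" by (simp add: addresses_0 cylinder_Nil)
qed

lemma compact_limit_set: "compact limit_set"
proof -
  have "compact (\<Union>ws\<in>addresses 0 k. cylinder ws)" for k
    by (intro compact_UN finite_addresses) (auto intro: compact_cylinder)
  then have "closed limit_set" unfolding limit_set_def by (intro closed_INT) (auto intro: compact_imp_closed)
  then show ?thesis using compact_Int_closed[OF compact_H] limit_set_subset by (metis inf.absorb_iff2)
qed

lemma limit_set_meets_cylinder:
  assumes ws: "ws \<in> addresses 0 k" shows "limit_set \<inter> cylinder ws \<noteq> {}"
proof -
  obtain c where c: "\<And>i. c i \<in> S i" using S_ne by (meson ex_in_conv)
  define e where "e m = ws @ map c [k..<k + m]" for m
  have e: "e m \<in> addresses 0 (k + m)" for m
    using ws c unfolding e_def addresses_def by (auto simp: nth_append)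
  have e_take: "take (k + m) (e n) = e m" if "m \<le> n" for m n
    using that ws by (simp add: e_def addresses_def take_map)
  have "(\<Inter>m. cylinder (e m)) \<noteq> {}"
  proof (rule compact_nest)
    fix m n :: nat assume "m \<le> n"
    then show "cylinder (e n) \<subseteq> cylinder (e m)"
      using cylinder_take[OF e[of n], of "k + m"] e_take by simp
  qed (use e in \<open>auto intro: compact_cylinder simp: cylinder_ne\<close>)
  then obtain x where x: "x \<in> cylinder (e m)" for m by blast
  have "\<exists>vs\<in>addresses 0 j. x \<in> cylinder vs" for j
    using take_in_addresses[OF e[of j], of j] cylinder_take[OF e[of j], of j] x by auto
  moreover have "x \<in> cylinder ws" using x[of 0] by (simp add: e_def)
  ultimately have "x \<in> limit_set \<inter> cylinder ws" by (simp add: limit_set_def)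
  then show ?thesis by blast
qed

text \<open>The cone condition: the limit set is a Lipschitz graph over the values of \<open>P 0\<close>. Two distinct points
have different addresses at some level, and at the first difference the distance is at most
\<open>\<rho> ^ j * D\<close> while the projections differ by at least \<open>\<rho> ^ (j + 1) * D\<close>.\<close>

lemma limit_set_cone:
  assumes x: "x \<in> limit_set" and y: "y \<in> limit_set"
  shows "dist x y \<le> (1 / \<rho>) * \<bar>P 0 x - P 0 y\<bar>"
proof (cases "x = y")
  case False
  then have "0 < dist x y / D" using D by simp
  then obtain k where k: "\<rho> ^ k < dist x y / D" using real_arch_pow_inv[OF _ \<rho>(2)] by blast
  obtain ws where ws: "ws \<in> addresses 0 k" "x \<in> cylinder ws" by (rule limit_set_address[OF x])
  obtain ws' where ws': "ws' \<in> addresses 0 k" "y \<in> cylinder ws'" by (rule limit_set_address[OF y])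
  have diam: "dist x y \<le> \<rho> ^ k * D" if "ws \<in> addresses i k" "x \<in> cylinder ws" "y \<in> cylinder ws" for i k ws x y
    using that
  proof (induction k arbitrary: i ws x y)
    case (Suc k)
    then obtain w vs where "ws = w # vs" "w \<in> S i" "vs \<in> addresses (Suc i) k"
      by (auto simp: addresses_Suc)
    then show ?case using Suc.IH[of vs "Suc i"] Suc.prems dist_f \<rho> by (auto simp: cylinder_Cons mult.assoc)
  qed (auto simp: addresses_0 cylinder_Nil dist_H)
  have "ws \<noteq> ws'" using diam[OF ws, of y] ws' k D by (auto simp: field_simps)
  then obtain j where j: "dist x y \<le> \<rho> ^ j * D" "\<rho> ^ Suc j * D \<le> \<bar>P 0 x - P 0 y\<bar>"
    using cylinders_separated[OF ws(1) ws'(1) _ ws(2) ws'(2)] by blast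
  have "dist x y \<le> (1 / \<rho>) * (\<rho> ^ Suc j * D)" using j \<rho> by simp
  also have "\<dots> \<le> (1 / \<rho>) * \<bar>P 0 x - P 0 y\<bar>" using j(2) \<rho> by (intro mult_left_mono) auto
  finally show ?thesis .
qed simp

text \<open>The natural probability measure on addresses gives a cylinder of level \<open>l\<close> the mass
\<open>1 / card (addresses 0 l)\<close>. That a finite cover by cylinders has total mass at least 1 is seen by
counting addresses of a level beyond all of theirs.\<close>

lemma sum_inverse_card_ge_1:
  assumes I: "finite I" and u: "\<And>q. q \<in> I \<Longrightarrow> u q \<in> addresses 0 (l q)"
    and cov: "limit_set \<subseteq> (\<Union>q\<in>I. cylinder (u q))"
  shows "1 \<le> (\<Sum>q\<in>I. 1 / real (card (addresses 0 (l q))))"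
proof -
  define m where "m = Max (insert 0 (l ` I))"
  have lm: "l q \<le> m" if "q \<in> I" for q using that I by (auto simp: m_def)
  define B where "B q = {ws \<in> addresses 0 m. take (l q) ws = u q}" for q
  have "addresses 0 m \<subseteq> (\<Union>q\<in>I. B q)"
  proof
    fix ws assume ws: "ws \<in> addresses 0 m"
    obtain x where x: "x \<in> limit_set" "x \<in> cylinder ws" using limit_set_meets_cylinder[OF ws] by blast
    then obtain q where q: "q \<in> I" "x \<in> cylinder (u q)" using cov by blast
    have x': "x \<in> cylinder (take (l q) ws)" using cylinder_take[OF ws lm[OF q(1)]] x by blast
    have "take (l q) ws = u q"
    proof (rule ccontr)
      assume "take (l q) ws \<noteq> u q"
      then obtain j where "\<rho> ^ Suc j * D \<le> \<bar>P 0 x - P 0 x\<bar>"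
        using cylinders_separated[OF take_in_addresses[OF ws lm[OF q(1)]] u[OF q(1)] _ x' q(2)] by blast
      moreover have "0 < \<rho> ^ Suc j * D" using \<rho> D by simp
      ultimately show False by simp
    qed
    then show "ws \<in> (\<Union>q\<in>I. B q)" using ws q by (auto simp: B_def)
  qed
  then have "card (addresses 0 m) \<le> card (\<Union>q\<in>I. B q)"
    using I by (intro card_mono) (auto simp: B_def finite_addresses)
  also have "\<dots> \<le> (\<Sum>q\<in>I. card (B q))" by (rule card_UN_le[OF I])
  finally have "real (card (addresses 0 m)) \<le> (\<Sum>q\<in>I. real (card (B q)))"
    by (metis of_nat_le_iff of_nat_sum)
  also have "\<dots> \<le> (\<Sum>q\<in>I. real (card (addresses 0 m)) * (1 / real (card (addresses 0 (l q)))))"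
  proof (rule sum_mono)
    fix q assume q: "q \<in> I"
    have "inj_on (drop (l q)) (B q)"
      by (rule inj_onI) (metis (mono_tags, lifting) B_def append_take_drop_id mem_Collect_eq)
    moreover have "drop (l q) ` B q \<subseteq> addresses (0 + l q) (m - l q)"
      using drop_in_addresses[OF _ lm[OF q], of _ 0] by (auto simp: B_def)
    ultimately have "card (B q) \<le> card (addresses (0 + l q) (m - l q))"
      by (rule card_inj_on_le) (rule finite_addresses)
    moreover have "card (addresses 0 m) = card (addresses 0 (l q)) * card (addresses (0 + l q) (m - l q))"
      using card_addresses_add[of 0 "l q" "m - l q"] lm[OF q] by simp
    ultimately show "real (card (B q)) \<le> real (card (addresses 0 m)) * (1 / real (card (addresses 0 (l q))))"
      using card_addresses_pos[of 0 "l q"] by simp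
  qed
  also have "\<dots> = real (card (addresses 0 m)) * (\<Sum>q\<in>I. 1 / real (card (addresses 0 (l q))))"
    by (rule sum_distrib_left[symmetric])
  finally show ?thesis using card_addresses_pos[of 0 m] by simp
qed

lemma small_set_in_cylinder:
  assumes U: "bounded U" "x \<in> U \<inter> limit_set" and l: "l = 0 \<or> diameter U < \<rho> ^ l * D"
  shows "\<exists>u\<in>addresses 0 l. U \<inter> limit_set \<subseteq> cylinder u"
proof -
  obtain u where u: "u \<in> addresses 0 l" "x \<in> cylinder u" using U limit_set_address by (metis IntE)
  have "y \<in> cylinder u" if y: "y \<in> U \<inter> limit_set" for y
  proof (rule ccontr)
    assume n: "y \<notin> cylinder u"
    obtain u' where u': "u' \<in> addresses 0 l" "y \<in> cylinder u'" using y limit_set_address by (metis IntE)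
    have "u \<noteq> u'" using n u' by blast
    then obtain j where j: "j < l" "\<rho> ^ Suc j * D \<le> \<bar>P 0 x - P 0 y\<bar>"
      using cylinders_separated[OF u(1) u'(1) _ u(2) u'(2)] by blast
    have "\<rho> ^ l \<le> \<rho> ^ Suc j" using j(1) \<rho> by (intro power_decreasing) auto
    then have "\<rho> ^ l * D \<le> dist x y" using j(2) P_0[of x y] D
      by (meson mult_right_mono less_imp_le order_trans)
    also have "\<dots> \<le> diameter U" using U y by (intro diameter_bounded_bound) auto
    finally show False using l j(1) by auto
  qed
  then show ?thesis using u by blast
qed

text \<open>The level at which a set of diameter \<open>d\<close> fits into one cylinder, with the mass of that cylinder
compared to \<open>d powr t\<close>. The error \<open>\<eta>\<close> is there for \<open>d = 0\<close>, where only arbitrarily small, not zero, mass can be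
reached.\<close>

lemma exists_level:
  assumes growth: "\<And>k. 1 \<le> real (card (addresses 0 k)) * (\<rho> powr s) ^ k"
    and t: "0 < t" "t \<le> s" and d: "0 \<le> d" and \<eta>: "0 < \<eta>"
  shows "\<exists>l. (l = 0 \<or> d < \<rho> ^ l * D) \<and> 1 / real (card (addresses 0 l)) \<le> d powr t / (\<rho> * D) powr t + \<eta>"
proof -
  have Z: "1 / real (card (addresses 0 k)) \<le> (\<rho> ^ k) powr t" for k
  proof -
    have "1 / real (card (addresses 0 k)) \<le> (\<rho> powr s) ^ k"
      using growth[of k] card_addresses_pos[of 0 k] by (simp add: field_simps)
    also have "\<dots> \<le> (\<rho> powr t) ^ k"
      using \<rho> t by (intro power_mono powr_mono') auto
    also have "\<dots> = (\<rho> ^ k) powr t" using \<rho> by (simp add: powr_powr powr_realpow[symmetric] mult.commute)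
    finally show ?thesis .
  qed
  consider "d = 0" | "D \<le> d" | "0 < d" "d < D" using d by linarith
  then show ?thesis
  proof cases
    case 1
    have "0 < \<eta> powr (1/t)" using \<eta> by simp
    then obtain l where l: "\<rho> ^ l < \<eta> powr (1/t)" using real_arch_pow_inv[OF _ \<rho>(2)] by blast
    have "(\<rho> ^ l) powr t \<le> (\<eta> powr (1/t)) powr t" using l \<rho> t by (intro powr_mono2) auto
    also have "\<dots> = \<eta>" using t \<eta> by (simp add: powr_powr)
    finally have "1 / real (card (addresses 0 l)) \<le> \<eta>" using Z[of l] by linarith
    then show ?thesis using 1 \<rho> D t by (intro exI[of _ l]) auto
  next
    case 2
    have "\<rho> * D \<le> d" using 2 \<rho> D mult_right_mono[of \<rho> 1 D] by linarith
    then have "1 \<le> d powr t / (\<rho> * D) powr t"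
      using \<rho> D t powr_mono2[of t "\<rho> * D" d] by (simp add: field_simps)
    then show ?thesis using \<eta> by (intro exI[of _ 0]) (auto simp: addresses_0)
  next
    case 3
    then have "0 < d / D" using D by simp
    then obtain n where n: "\<rho> ^ n < d / D" using real_arch_pow_inv[OF _ \<rho>(2)] by blast
    define n' where "n' = (LEAST n. \<rho> ^ n * D \<le> d)"
    have n'1: "\<rho> ^ n' * D \<le> d" unfolding n'_def by (rule LeastI[of _ n]) (use n D in \<open>simp add: field_simps\<close>)
    then have "n' \<noteq> 0" using 3 by (auto intro: ccontr)
    then obtain l where l: "n' = Suc l" using not0_implies_Suc by blast
    have "d < \<rho> ^ l * D" using not_less_Least[of l "\<lambda>n. \<rho> ^ n * D \<le> d"] l n'_def by auto
    moreover have "1 / real (card (addresses 0 l)) \<le> d powr t / (\<rho> * D) powr t"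
    proof -
      have "(\<rho> ^ l) powr t * (\<rho> * D) powr t = (\<rho> ^ n' * D) powr t"
        using \<rho> D by (simp add: l powr_mult ac_simps)
      also have "\<dots> \<le> d powr t" using n'1 \<rho> D t by (intro powr_mono2) auto
      finally have "(\<rho> ^ l) powr t \<le> d powr t / (\<rho> * D) powr t" using \<rho> D by (simp add: field_simps)
      then show ?thesis using Z[of l] by linarith
    qed
    ultimately show ?thesis using \<eta> by (intro exI[of _ l]) auto
  qed
qed

text \<open>The mass distribution principle. A cover with too small a sum could be exchanged, set by set, for a
cover by cylinders of total mass less than 1. Cylinders are relatively open, so finitely many of them would
suffice, against \<open>sum_inverse_card_ge_1\<close>.\<close>

lemma hausdorff_premeasure_limit_set:
  assumes growth: "\<And>k. 1 \<le> real (card (addresses 0 k)) * (\<rho> powr s) ^ k"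
    and t: "0 < t" "t \<le> s"
  shows "ennreal ((\<rho> * D) powr t) \<le> hausdorff_premeasure t \<delta> limit_set"
  unfolding hausdorff_premeasure_def
proof (rule INF_greatest)
  fix U :: "nat \<Rightarrow> 'a set"
  assume "U \<in> {U. limit_set \<subseteq> (\<Union>i. U i) \<and> (\<forall>i. bounded (U i) \<and> diameter (U i) \<le> \<delta>)}"
  then have cov: "limit_set \<subseteq> (\<Union>i. U i)" and bdd: "\<And>i. bounded (U i)" by auto
  define c where "c = (\<rho> * D) powr t"
  have c: "0 < c" using \<rho> D by (simp add: c_def)
  have dp: "diam_pow t (U i) = ennreal (diameter (U i) powr t)" for i
    using t by (auto simp: diam_pow_def)
  show "ennreal ((\<rho> * D) powr t) \<le> (\<Sum>i. diam_pow t (U i))"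
  proof (rule ccontr)
    assume "\<not> ?thesis"
    then have lt: "(\<Sum>i. diam_pow t (U i)) < ennreal c" by (simp add: c_def)
    then obtain \<Sigma> where \<Sigma>: "0 \<le> \<Sigma>" "(\<Sum>i. diam_pow t (U i)) = ennreal \<Sigma>"
      by (metis ennreal_cases infinity_ennreal_def not_less_iff_gr_or_eq ennreal_less_top order.strict_trans)
    have \<Sigma>c: "\<Sigma> < c" using lt \<Sigma> by (simp add: ennreal_less_iff)
    define \<eta> where "\<eta> = (1 - \<Sigma> / c) / 2"
    have \<eta>: "0 < \<eta>" using \<Sigma>c c by (simp add: \<eta>_def)
    define N where "N = {i. U i \<inter> limit_set \<noteq> {}}"
    have "\<exists>l u. u \<in> addresses 0 l \<and> U i \<inter> limit_set \<subseteq> cylinder u \<and>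
        1 / real (card (addresses 0 l)) \<le> diameter (U i) powr t / c + \<eta> * (1/2) ^ Suc i"
      if "i \<in> N" for i
    proof -
      obtain l where "l = 0 \<or> diameter (U i) < \<rho> ^ l * D"
        "1 / real (card (addresses 0 l)) \<le> diameter (U i) powr t / c + \<eta> * (1/2) ^ Suc i"
        using exists_level[OF growth t diameter_ge_0[OF bdd[of i]], of "\<eta> * (1/2) ^ Suc i"] \<eta>
        unfolding c_def by auto
      then show ?thesis using small_set_in_cylinder[OF bdd[of i]] that unfolding N_def by blast
    qed
    then obtain l u where u: "\<And>i. i \<in> N \<Longrightarrow> u i \<in> addresses 0 (l i)"
      and Uu: "\<And>i. i \<in> N \<Longrightarrow> U i \<inter> limit_set \<subseteq> cylinder (u i)"
      and wt: "\<And>i. i \<in> N \<Longrightarrow> 1 / real (card (addresses 0 (l i))) \<le> diameter (U i) powr t / c + \<eta> * (1/2) ^ Suc i"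
      by metis
    \<comment> \<open>Within the limit set, a cylinder is the complement of the finitely many other cylinders of its
      level, which are closed.\<close>
    define V where "V i = - (\<Union>u'\<in>addresses 0 (l i) - {u i}. cylinder u')" for i
    have "open (V i)" for i
      unfolding V_def by (intro open_Compl closed_UN finite_Diff finite_addresses)
        (auto intro: compact_imp_closed compact_cylinder)
    moreover have Vsub: "limit_set \<inter> V i \<subseteq> cylinder (u i)" for i
    proof
      fix x assume x: "x \<in> limit_set \<inter> V i"
      then obtain ws where "ws \<in> addresses 0 (l i)" "x \<in> cylinder ws" using limit_set_address by (metis IntE)
      then show "x \<in> cylinder (u i)" using x by (cases "ws = u i") (auto simp: V_def)
    qed
    moreover have "limit_set \<subseteq> (\<Union>i\<in>N. V i)"
    proof
      fix x assume x: "x \<in> limit_set"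
      then obtain i where i: "x \<in> U i" using cov by blast
      then have N: "i \<in> N" using x by (auto simp: N_def)
      have xu: "x \<in> cylinder (u i)" using Uu[OF N] i x by blast
      have "x \<notin> cylinder u'" if u': "u' \<in> addresses 0 (l i)" "u' \<noteq> u i" for u'
      proof
        assume "x \<in> cylinder u'"
        then obtain j where "\<rho> ^ Suc j * D \<le> \<bar>P 0 x - P 0 x\<bar>"
          using cylinders_separated[OF u'(1) u[OF N] u'(2) _ xu] by blast
        moreover have "0 < \<rho> ^ Suc j * D" using \<rho> D by simp
        ultimately show False by simp
      qed
      then show "x \<in> (\<Union>i\<in>N. V i)" using N by (auto simp: V_def)
    qed
    ultimately obtain I where I: "I \<subseteq> N" "finite I" "limit_set \<subseteq> (\<Union>i\<in>I. V i)"
      using compactE_image[OF compact_limit_set, of N V] by metis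
    then have "limit_set \<subseteq> (\<Union>i\<in>I. cylinder (u i))" using Vsub by blast
    then have "1 \<le> (\<Sum>i\<in>I. 1 / real (card (addresses 0 (l i))))"
      using I u by (intro sum_inverse_card_ge_1) auto
    also have "\<dots> \<le> (\<Sum>i\<in>I. diameter (U i) powr t / c + \<eta> * (1/2) ^ Suc i)"
      using I wt by (intro sum_mono) auto
    also have "\<dots> = (\<Sum>i\<in>I. diameter (U i) powr t) / c + \<eta> * (\<Sum>i\<in>I. (1/2) ^ Suc i)"
      by (simp add: sum.distrib sum_divide_distrib sum_distrib_left)
    finally have le: "1 \<le> (\<Sum>i\<in>I. diameter (U i) powr t) / c + \<eta> * (\<Sum>i\<in>I. (1/2) ^ Suc i)" .
    have "(\<Sum>i\<in>I. diameter (U i) powr t) \<le> \<Sigma>"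
    proof -
      have "ennreal (\<Sum>i\<in>I. diameter (U i) powr t) = (\<Sum>i\<in>I. diam_pow t (U i))"
        unfolding dp by (rule sum_ennreal[symmetric]) auto
      also have "\<dots> \<le> (\<Sum>i. diam_pow t (U i))" by (rule sum_le_suminf) (auto simp: I)
      finally show ?thesis using \<Sigma> by simp
    qed
    then have 1: "(\<Sum>i\<in>I. diameter (U i) powr t) / c \<le> \<Sigma> / c" using c by (intro divide_right_mono) auto
    have "(\<Sum>i\<in>I. (1/2) ^ Suc i) \<le> (1 :: real)"
    proof -
      have "(\<Sum>i\<in>I. (1/2) ^ Suc i) \<le> (\<Sum>i. (1/2 :: real) ^ Suc i)"
        using I(2) power_half_series by (intro sum_le_suminf) (auto simp: sums_iff)
      then show ?thesis using power_half_series by (simp add: sums_iff)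
    qed
    then have "\<eta> * (\<Sum>i\<in>I. (1/2) ^ Suc i) \<le> \<eta> * 1" using \<eta> by (intro mult_left_mono) auto
    then have "1 \<le> \<Sigma> / c + \<eta>" using le 1 by linarith
    then show False using \<eta> by (simp add: \<eta>_def field_simps)
  qed
qed

lemma hausdorff_dim_limit_set:
  assumes growth: "\<And>k. 1 \<le> real (card (addresses 0 k)) * (\<rho> powr s) ^ k"
  shows "ereal s \<le> hausdorff_dim limit_set"
  unfolding hausdorff_dim_def
proof (rule Inf_greatest, clarify)
  fix t :: real assume t: "0 \<le> t" "hausdorff_measure t limit_set = 0"
  show "ereal s \<le> ereal t"
  proof (rule ccontr)
    assume "\<not> ?thesis"
    then have ts: "t < s" by simp
    have "hausdorff_premeasure t 1 limit_set \<le> hausdorff_measure t limit_set"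
      by (rule hausdorff_premeasure_le_measure) simp
    moreover have "0 < hausdorff_premeasure t 1 limit_set"
    proof (cases "t = 0")
      case False
      then have "ennreal ((\<rho> * D) powr t) \<le> hausdorff_premeasure t 1 limit_set"
        using t ts by (intro hausdorff_premeasure_limit_set[OF growth]) auto
      moreover have "0 < ennreal ((\<rho> * D) powr t)" using \<rho> D by simp
      ultimately show ?thesis by (rule order.strict_trans2[rotated])
    next
      case True
      have "limit_set \<noteq> {}" using limit_set_meets_cylinder[of "[]" 0] by (auto simp: addresses_0)
      then have "1 \<le> hausdorff_premeasure 0 1 limit_set"
        unfolding hausdorff_premeasure_def
      proof (intro INF_greatest)
        fix U :: "nat \<Rightarrow> 'a set"
        assume "limit_set \<noteq> {}" "U \<in> {U. limit_set \<subseteq> (\<Union>i. U i) \<and> (\<forall>i. bounded (U i) \<and> diameter (U i) \<le> 1)}"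
        then obtain i where "U i \<noteq> {}" by blast
        then have "1 = diam_pow 0 (U i)" by (simp add: diam_pow_def)
        also have "\<dots> = (\<Sum>i\<in>{i}. diam_pow 0 (U i))" by simp
        also have "\<dots> \<le> (\<Sum>i. diam_pow 0 (U i))" by (rule sum_le_suminf) auto
        finally show "1 \<le> (\<Sum>i. diam_pow 0 (U i))" .
      qed
      then show ?thesis using True by (metis order.strict_trans2 zero_less_one)
    qed
    ultimately show False using t by simp
  qed
qed

end


section \<open>Similarities and their action on directions\<close>

text \<open>A planar similarity, described by its effect on projections alone: applying it and projecting in
direction \<open>\<theta>\<close> is, up to a constant, \<open>\<rho>\<close> times the projection in direction \<open>s * (\<theta> - \<alpha>)\<close>. Its linear
part is \<open>\<rho>\<close> times the rotation by \<open>\<alpha>\<close>, preceded by the reflection in the first axis when \<open>s = -1\<close>.\<close>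

definition motion :: "real \<Rightarrow> real \<Rightarrow> int \<Rightarrow> (real^2 \<Rightarrow> real^2) \<Rightarrow> bool" where
  "motion \<rho> \<alpha> s g \<longleftrightarrow> 0 < \<rho> \<and> s \<in> {1, -1} \<and>
     (\<forall>\<theta> x y. angle_proj \<theta> (g x) - angle_proj \<theta> (g y) =
        \<rho> * (angle_proj (of_int s * (\<theta> - \<alpha>)) x - angle_proj (of_int s * (\<theta> - \<alpha>)) y))"

lemma motion_comp:
  assumes g: "motion \<rho> \<alpha> s g" and h: "motion \<rho>' \<alpha>' s' h"
  shows "motion (\<rho> * \<rho>') (\<alpha> + of_int s * \<alpha>') (s * s') (g \<circ> h)"
proof -
  have s: "s = 1 \<or> s = -1" "s' = 1 \<or> s' = -1" using g h by (auto simp: motion_def)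
  have "real_of_int (s * s') * (\<theta> - (\<alpha> + of_int s * \<alpha>')) = of_int s' * (of_int s * (\<theta> - \<alpha>) - \<alpha>')" for \<theta>
    using s by (auto simp: algebra_simps)
  then have P: "angle_proj \<theta> ((g \<circ> h) x) - angle_proj \<theta> ((g \<circ> h) y) = \<rho> * \<rho>' *
      (angle_proj (real_of_int (s * s') * (\<theta> - (\<alpha> + of_int s * \<alpha>'))) x
       - angle_proj (real_of_int (s * s') * (\<theta> - (\<alpha> + of_int s * \<alpha>'))) y)" for \<theta> x y
    using g h by (simp only: motion_def comp_apply mult.assoc)
  have "0 < \<rho> * \<rho>'" "s * s' \<in> {1, -1}" using g h s by (auto simp: motion_def)
  then show ?thesis using P unfolding motion_def by blast
qed

lemma motion_dist:
  assumes "motion \<rho> \<alpha> s g" shows "dist (g x) (g y) = \<rho> * dist x y"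
proof -
  define u where "u = g x - g y"
  define v where "v = x - y"
  have s: "s = 1 \<or> s = -1" and \<rho>: "0 < \<rho>" using assms by (auto simp: motion_def)
  have P: "angle_proj \<theta> u = \<rho> * angle_proj (of_int s * (\<theta> - \<alpha>)) v" for \<theta>
    using assms by (simp add: motion_def u_def v_def angle_proj_diff)
  have "angle_proj (of_int s * (\<alpha> + pi/2 - \<alpha>)) v = of_int s * angle_proj (0 + pi/2) v"
    using s by (auto simp: angle_proj_def)
  then have q: "(angle_proj (of_int s * (\<alpha> + pi/2 - \<alpha>)) v)\<^sup>2 = (angle_proj (0 + pi/2) v)\<^sup>2"
    using s by auto
  have "(norm u)\<^sup>2 = (angle_proj \<alpha> u)\<^sup>2 + (angle_proj (\<alpha> + pi/2) u)\<^sup>2" by (rule norm_eq_angle_proj)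
  also have "\<dots> = \<rho>\<^sup>2 * ((angle_proj 0 v)\<^sup>2 + (angle_proj (0 + pi/2) v)\<^sup>2)"
    unfolding P power_mult_distrib q by (simp add: algebra_simps)
  also have "\<dots> = (\<rho> * norm v)\<^sup>2"
    unfolding norm_eq_angle_proj[of v 0, symmetric] by (simp add: power_mult_distrib)
  finally have "norm u = \<rho> * norm v" using \<rho> by (simp add: power2_eq_iff_nonneg)
  then show ?thesis by (simp add: u_def v_def dist_norm)
qed

text \<open>An orthogonal matrix has a unit vector \<open>(cos \<alpha>, sin \<alpha>)\<close> as first column, and its second column is this
vector turned by a right angle, up to the sign given by the determinant \<open>t\<close>.\<close>

lemma motion_ifs_map:
  assumes A: "orthogonal_matrix (A k)" and r: "0 < r k"
  shows "\<exists>\<alpha> s. motion (r k) \<alpha> s (ifs_map r A z k)"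
proof -
  define a b c d where "a = A k $ 1 $ 1" and "b = A k $ 1 $ 2" and "c = A k $ 2 $ 1" and "d = A k $ 2 $ 2"
  note abcd = a_def b_def c_def d_def
  have "transpose (A k) ** A k = mat 1" using A by (simp add: orthogonal_matrix)
  then have "(\<forall>i j. (transpose (A k) ** A k) $ i $ j = mat 1 $ i $ j)" by simp
  then have e: "a\<^sup>2 + c\<^sup>2 = 1" "a * b + c * d = 0" "b\<^sup>2 + d\<^sup>2 = 1"
    unfolding forall_2 matrix_matrix_mult_def transpose_def mat_def
    by (simp_all add: sum_2 abcd power2_eq_square)
  define t where "t = a * d - b * c"
  have "- t * c = b * (a\<^sup>2 + c\<^sup>2) - a * (a * b + c * d)" by (simp add: t_def power2_eq_square algebra_simps)
  then have b: "b = - t * c" by (simp add: e)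
  have "t * a = d * (a\<^sup>2 + c\<^sup>2) - c * (a * b + c * d)" by (simp add: t_def power2_eq_square algebra_simps)
  then have d: "d = t * a" by (simp add: e)
  have "t\<^sup>2 * (a\<^sup>2 + c\<^sup>2) = b\<^sup>2 + d\<^sup>2" unfolding b d by (simp add: power_mult_distrib algebra_simps)
  then have t: "t = 1 \<or> t = -1" by (simp add: e power2_eq_1_iff)
  define s :: int where "s = (if t = 1 then 1 else -1)"
  have s: "t = of_int s" "s \<in> {1, -1}" using t by (auto simp: s_def)
  obtain \<alpha> where \<alpha>: "a = cos \<alpha>" "c = sin \<alpha>" using sincos_total_2pi[OF e(1)] by blast
  have "angle_proj \<theta> (ifs_map r A z k x) = r k * angle_proj (of_int s * (\<theta> - \<alpha>)) x + angle_proj \<theta> (z k)"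
    for \<theta> x
  proof -
    have "(A k *v x) $ 1 = a * x $ 1 + b * x $ 2" "(A k *v x) $ 2 = c * x $ 1 + d * x $ 2"
      by (simp_all add: matrix_vector_mult_def sum_2 abcd)
    then have "angle_proj \<theta> (ifs_map r A z k x)
      = r k * (x $ 1 * (a * cos \<theta> + c * sin \<theta>) + x $ 2 * (b * cos \<theta> + d * sin \<theta>)) + angle_proj \<theta> (z k)"
      by (simp add: ifs_map_def angle_proj_def algebra_simps)
    also have "a * cos \<theta> + c * sin \<theta> = cos (\<theta> - \<alpha>)" by (simp add: \<alpha> cos_diff algebra_simps)
    also have "b * cos \<theta> + d * sin \<theta> = t * sin (\<theta> - \<alpha>)" by (simp add: b d \<alpha> sin_diff algebra_simps)
    also have "x $ 1 * cos (\<theta> - \<alpha>) + x $ 2 * (t * sin (\<theta> - \<alpha>)) = angle_proj (of_int s * (\<theta> - \<alpha>)) x"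
      using s cos_minus[of "\<theta> - \<alpha>"] sin_minus[of "\<theta> - \<alpha>"] by (auto simp: angle_proj_def)
    finally show ?thesis .
  qed
  then have "motion (r k) \<alpha> s (ifs_map r A z k)"
    using s r by (simp add: motion_def algebra_simps)
  then show ?thesis by blast
qed

section \<open>Words with the same linear part\<close>

definition word_ratio :: "(nat \<Rightarrow> real) \<Rightarrow> nat list \<Rightarrow> real" where
  "word_ratio r w = prod_list (map r w)"

definition word_sign :: "(nat \<Rightarrow> int) \<Rightarrow> nat list \<Rightarrow> int" where
  "word_sign s w = prod_list (map s w)"

primrec word_angle :: "(nat \<Rightarrow> real) \<Rightarrow> (nat \<Rightarrow> int) \<Rightarrow> nat list \<Rightarrow> real" where
  "word_angle \<alpha> s [] = 0"
| "word_angle \<alpha> s (k # w) = \<alpha> k + of_int (s k) * word_angle \<alpha> s w"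

text \<open>Reading a word from the left, a letter contributes its angle with sign \<open>-1\<close> when an odd number of
reflections stands before it. This is the signed number of occurrences of \<open>k\<close>.\<close>

primrec letter_turns :: "(nat \<Rightarrow> int) \<Rightarrow> nat \<Rightarrow> nat list \<Rightarrow> int" where
  "letter_turns s k [] = 0"
| "letter_turns s k (i # w) = of_bool (i = k) + s i * letter_turns s k w"

lemma word_map_Nil: "word_map f [] = id"
  by (simp add: word_map_def)

lemma word_map_Cons: "word_map f (k # w) = f k \<circ> word_map f w"
  by (simp add: word_map_def)

lemma motion_word_map:
  assumes "\<And>k. k \<in> {1..M} \<Longrightarrow> motion (r k) (\<alpha> k) (s k) (f k)" and "set w \<subseteq> {1..M}"
  shows "motion (word_ratio r w) (word_angle \<alpha> s w) (word_sign s w) (word_map f w)"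
  using assms(2)
proof (induction w)
  case Nil
  then show ?case by (simp add: word_ratio_def word_sign_def word_map_Nil motion_def)
next
  case (Cons k w)
  then show ?case using motion_comp[OF assms(1)[of k] Cons.IH]
    by (simp add: word_ratio_def word_sign_def word_map_Cons comp_def)
qed

lemma word_ratio_eq_prod_count:
  "set w \<subseteq> {1..M} \<Longrightarrow> word_ratio r w = (\<Prod>k\<in>{1..M}. r k ^ count_list w k)"
proof (induction w)
  case (Cons i w)
  have "(\<Prod>k\<in>{1..M}. r k ^ count_list (i # w) k)
      = (\<Prod>k\<in>{1..M}. (if k = i then r k else 1) * r k ^ count_list w k)"
    by (rule prod.cong) auto
  also have "\<dots> = r i * (\<Prod>k\<in>{1..M}. r k ^ count_list w k)"
    using Cons.prems by (simp add: prod.distrib)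
  finally show ?case using Cons by (simp add: word_ratio_def)
qed (simp add: word_ratio_def)

lemma word_angle_eq_sum_turns:
  "set w \<subseteq> {1..M} \<Longrightarrow> word_angle \<alpha> s w = (\<Sum>k\<in>{1..M}. of_int (letter_turns s k w) * \<alpha> k)"
proof (induction w)
  case (Cons i w)
  have "(\<Sum>k\<in>{1..M}. of_int (letter_turns s k (i # w)) * \<alpha> k)
      = (\<Sum>k\<in>{1..M}. (if k = i then \<alpha> k else 0) + of_int (s i) * (of_int (letter_turns s k w) * \<alpha> k))"
    by (rule sum.cong) (auto simp: algebra_simps)
  also have "\<dots> = \<alpha> i + of_int (s i) * (\<Sum>k\<in>{1..M}. of_int (letter_turns s k w) * \<alpha> k)"
    using Cons.prems by (simp add: sum.distrib sum_distrib_left)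
  finally show ?case using Cons by simp
qed simp

lemma abs_letter_turns_le:
  assumes s: "\<And>k. k \<in> {1..M} \<Longrightarrow> s k \<in> {1, -1}" and w: "set w \<subseteq> {1..M}"
  shows "\<bar>letter_turns s k w\<bar> \<le> int (length w)"
  using w
proof (induction w)
  case (Cons i w)
  then have "s i = 1 \<or> s i = -1" using s[of i] by auto
  then show ?case using Cons by auto
qed simp

lemma word_sign_in:
  assumes s: "\<And>k. k \<in> {1..M} \<Longrightarrow> s k \<in> {1, -1}" and w: "set w \<subseteq> {1..M}"
  shows "word_sign s w \<in> {1, -1}"
  using w
proof (induction w)
  case (Cons i w)
  then have "s i = 1 \<or> s i = -1" using s[of i] by auto
  then show ?case using Cons by (auto simp: word_sign_def)
qed (simp add: word_sign_def)

lemma exists_heavy_fibre: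
  fixes m :: "'a \<Rightarrow> real"
  assumes W: "finite W" and T: "finite T" "T \<noteq> {}" and ty: "ty ` W \<subseteq> T" and sum: "(\<Sum>w\<in>W. m w) = 1"
  shows "\<exists>\<tau>\<in>T. 1 / real (card T) \<le> (\<Sum>w\<in>{w\<in>W. ty w = \<tau>}. m w)"
proof (rule ccontr)
  assume "\<not> ?thesis"
  then have "(\<Sum>\<tau>\<in>T. \<Sum>w\<in>{w\<in>W. ty w = \<tau>}. m w) < (\<Sum>\<tau>\<in>T. 1 / real (card T))"
    using T by (intro sum_strict_mono) (auto simp: not_le)
  also have "\<dots> = 1" using T by simp
  finally show False using sum.group[OF W T(1) ty, of m] sum by simp
qed

text \<open>Rotations of the plane commute, so the linear part of a word depends only on how often each letter
occurs, on the signed numbers of occurrences, and on the sign of the word. For words of length at most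
\<open>N\<close> this leaves polynomially many linear parts in \<open>N\<close>, and one of them carries a
polynomially small fraction of the total weight. Restricting to it costs little, and then all maps used have the same ratio and
act on directions in the same way.\<close>

lemma exists_class_of_equal_motions:
  assumes f: "\<And>k. k \<in> {1..M} \<Longrightarrow> motion (r k) (\<alpha> k) (s k) (f k)"
    and W: "finite W" "\<And>w. w \<in> W \<Longrightarrow> set w \<subseteq> {1..M} \<and> length w \<le> N"
    and sum: "(\<Sum>w\<in>W. word_ratio r w) = 1"
  shows "\<exists>C\<subseteq>W. \<exists>\<rho> \<beta> \<sigma>. C \<noteq> {} \<and> (\<forall>w\<in>C. word_ratio r w = \<rho> \<and> motion \<rho> \<beta> \<sigma> (word_map f w)) \<and>
     1 \<le> 2 * ((real N + 1) * (2 * real N + 1)) ^ M * (real (card C) * \<rho>)"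
proof -
  have s: "s k \<in> {1, -1}" if "k \<in> {1..M}" for k using f[OF that] by (simp add: motion_def)
  define T where "T = (PiE {1..M} (\<lambda>_. {..N} \<times> {- int N..int N})) \<times> {1, -1 :: int}"
  define ty where "ty w = (restrict (\<lambda>k. (count_list w k, letter_turns s k w)) {1..M}, word_sign s w)" for w
  have T: "finite T" unfolding T_def by (intro finite_cartesian_product finite_PiE) auto
  have cT: "card T = ((N + 1) * (2 * N + 1)) ^ M * 2"
  proof -
    have "card ({..N} \<times> {- int N..int N}) = (N + 1) * (2 * N + 1)"
    proof -
      have "card {- int N..int N} = 2 * N + 1" by simp
      then show ?thesis unfolding card_cartesian_product by simp
    qed
    then show ?thesis
      unfolding T_def by (simp add: card_PiE card_cartesian_product)
  qed
  have ty: "ty ` W \<subseteq> T"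
  proof
    fix y assume "y \<in> ty ` W"
    then obtain w where w: "w \<in> W" "y = ty w" by blast
    have "count_list w k \<le> N" for k using count_le_length[of w k] W(2)[OF w(1)] by linarith
    moreover have "\<bar>letter_turns s k w\<bar> \<le> int N" for k
      using abs_letter_turns_le[of M s w k] s W(2)[OF w(1)] by force
    ultimately show "y \<in> T"
      using word_sign_in[of M s w] s W(2)[OF w(1)] by (auto simp: w T_def ty_def abs_le_iff minus_le_iff)
  qed
  have "W \<noteq> {}" using sum by auto
  then have Tne: "T \<noteq> {}" using ty by blast
  obtain \<tau> where \<tau>: "1 / real (card T) \<le> (\<Sum>w\<in>{w\<in>W. ty w = \<tau>}. word_ratio r w)"
    using exists_heavy_fibre[OF W(1) T Tne ty sum] by blast
  define C where "C = {w\<in>W. ty w = \<tau>}"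
  have cT0: "0 < card T" using T Tne by (simp add: card_gt_0_iff)
  have Cne: "C \<noteq> {}"
  proof
    assume "C = {}"
    then have "1 / real (card T) \<le> 0" using \<tau> unfolding C_def[symmetric] by simp
    then show False using cT0 by (simp add: field_simps)
  qed
  then obtain w0 where w0: "w0 \<in> C" by blast
  have same: "word_ratio r w = word_ratio r w0 \<and> word_angle \<alpha> s w = word_angle \<alpha> s w0 \<and> word_sign s w = word_sign s w0"
    if w: "w \<in> C" for w
  proof -
    have eq: "ty w = ty w0" using w w0 by (simp add: C_def)
    have "(count_list w k, letter_turns s k w) = (count_list w0 k, letter_turns s k w0)" if "k \<in> {1..M}" for k
      using fun_cong[OF arg_cong[OF eq, of fst], of k] that by (simp add: ty_def)
    then have "count_list w k = count_list w0 k" "letter_turns s k w = letter_turns s k w0" if "k \<in> {1..M}" for k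
      using that by auto
    moreover have "set w \<subseteq> {1..M}" "set w0 \<subseteq> {1..M}" using w w0 W(2) by (auto simp: C_def)
    ultimately show ?thesis using eq
      by (simp add: word_ratio_eq_prod_count[where M = M] word_angle_eq_sum_turns[where M = M] ty_def)
  qed
  have "motion (word_ratio r w0) (word_angle \<alpha> s w0) (word_sign s w0) (word_map f w)" if "w \<in> C" for w
    using motion_word_map[of M r \<alpha> s f w] f same[OF that] W(2)[of w] that by (simp add: C_def)
  moreover have "1 \<le> 2 * ((real N + 1) * (2 * real N + 1)) ^ M * (real (card C) * word_ratio r w0)"
  proof -
    have "(\<Sum>w\<in>C. word_ratio r w) = (\<Sum>w\<in>C. word_ratio r w0)" using same by (intro sum.cong) auto
    then have "(\<Sum>w\<in>C. word_ratio r w) = real (card C) * word_ratio r w0" by simp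
    then have "1 / real (card T) \<le> real (card C) * word_ratio r w0" using \<tau> by (simp add: C_def)
    then have "1 \<le> real (card T) * (real (card C) * word_ratio r w0)" using cT0 by (simp add: field_simps)
    also have "real (card T) = 2 * ((real N + 1) * (2 * real N + 1)) ^ M"
      unfolding cT of_nat_mult of_nat_power of_nat_add of_nat_1 of_nat_numeral by simp
    finally show ?thesis .
  qed
  ultimately show ?thesis using Cne same
    by (intro exI[of _ C] conjI exI[of _ "word_ratio r w0"] exI[of _ "word_angle \<alpha> s w0"] exI[of _ "word_sign s w0"])
      (auto simp: C_def)
qed

section \<open>Words of comparable ratio\<close>

text \<open>These are the words stopped as soon as their ratio falls to \<open>\<rho>\<close>. Words of one fixed length would not
do: their ratios may differ by a power, whereas both the dimension and the Lipschitz constant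
depend on the size of \<open>log (1/\<rho>)\<close>. The condition \<open>lo * \<rho> < 1\<close> instead of \<open>\<rho> \<le> 1\<close> lets the recursion pass to
\<open>\<rho> / r k\<close>, which may exceed 1.\<close>

lemma exists_stopping_words:
  assumes r: "\<And>k. k \<in> {1..M} \<Longrightarrow> lo \<le> r k \<and> r k \<le> hi" "0 < lo" "(\<Sum>k\<in>{1..M}. r k) = 1"
    and H: "H = (\<Union>k\<in>{1..M}. f k ` H)"
  shows "\<lbrakk>hi ^ N \<le> \<rho>; lo * \<rho> < 1\<rbrakk> \<Longrightarrow> \<exists>W. finite W \<and> (\<forall>w\<in>W. set w \<subseteq> {1..M} \<and> length w \<le> N) \<and>
     (\<forall>w\<in>W. lo * \<rho> < word_ratio r w \<and> word_ratio r w \<le> \<rho>) \<and>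
     (\<Sum>w\<in>W. word_ratio r w) = 1 \<and> H = (\<Union>w\<in>W. word_map f w ` H)"
proof (induction N arbitrary: \<rho>)
  case 0
  then show ?case by (intro exI[of _ "{[]}"]) (auto simp: word_ratio_def word_map_Nil)
next
  case (Suc N)
  show ?case
  proof (cases "1 \<le> \<rho>")
    case True
    then show ?thesis using Suc.prems
      by (intro exI[of _ "{[]}"]) (auto simp: word_ratio_def word_map_Nil)
  next
    case False
    have rp: "0 < r k" "r k \<le> hi" "lo \<le> r k" if "k \<in> {1..M}" for k using r that by force+
    have "\<exists>W. finite W \<and> (\<forall>w\<in>W. set w \<subseteq> {1..M} \<and> length w \<le> N) \<and>
       (\<forall>w\<in>W. lo * (\<rho> / r k) < word_ratio r w \<and> word_ratio r w \<le> \<rho> / r k) \<and>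
       (\<Sum>w\<in>W. word_ratio r w) = 1 \<and> H = (\<Union>w\<in>W. word_map f w ` H)" if k: "k \<in> {1..M}" for k
    proof (rule Suc.IH)
      have hi: "0 < hi" using rp[OF k] by linarith
      have "hi ^ N * r k \<le> hi ^ N * hi" using rp[OF k] hi by (intro mult_left_mono) auto
      also have "\<dots> \<le> \<rho>" using Suc.prems(1) by (simp add: mult.commute)
      finally show "hi ^ N \<le> \<rho> / r k" using rp[OF k] by (simp add: field_simps)
      have "lo * \<rho> < lo * 1" using False r(2) by (intro mult_strict_left_mono) auto
      then show "lo * (\<rho> / r k) < 1" using rp[OF k] by (simp add: field_simps)
    qed
    then obtain V where V: "\<And>k. k \<in> {1..M} \<Longrightarrow> finite (V k) \<and> (\<forall>w\<in>V k. set w \<subseteq> {1..M} \<and> length w \<le> N) \<and>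
       (\<forall>w\<in>V k. lo * (\<rho> / r k) < word_ratio r w \<and> word_ratio r w \<le> \<rho> / r k) \<and>
       (\<Sum>w\<in>V k. word_ratio r w) = 1 \<and> H = (\<Union>w\<in>V k. word_map f w ` H)"
      by metis
    define W where "W = (\<Union>k\<in>{1..M}. (#) k ` V k)"
    have "finite W" unfolding W_def using V by blast
    moreover have "\<forall>w\<in>W. set w \<subseteq> {1..M} \<and> length w \<le> Suc N" unfolding W_def using V by fastforce
    moreover have "\<forall>w\<in>W. lo * \<rho> < word_ratio r w \<and> word_ratio r w \<le> \<rho>"
    proof
      fix w assume "w \<in> W"
      then obtain k v where kv: "k \<in> {1..M}" "v \<in> V k" "w = k # v" by (auto simp: W_def)
      have "lo * (\<rho> / r k) < word_ratio r v" "word_ratio r v \<le> \<rho> / r k" using V kv by blast+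
      then show "lo * \<rho> < word_ratio r w \<and> word_ratio r w \<le> \<rho>"
        using rp[OF kv(1)] kv(3) by (simp add: word_ratio_def field_simps)
    qed
    moreover have "(\<Sum>w\<in>W. word_ratio r w) = 1"
    proof -
      have "(\<Sum>w\<in>W. word_ratio r w) = (\<Sum>k\<in>{1..M}. \<Sum>w\<in>(#) k ` V k. word_ratio r w)"
        unfolding W_def using V by (intro sum.UNION_disjoint) auto
      also have "\<dots> = (\<Sum>k\<in>{1..M}. r k * (\<Sum>w\<in>V k. word_ratio r w))"
        by (intro sum.cong) (auto simp: sum.reindex word_ratio_def sum_distrib_left)
      also have "\<dots> = (\<Sum>k\<in>{1..M}. r k)" using V by (intro sum.cong) auto
      finally show ?thesis using r(3) by simp
    qed
    moreover have "H = (\<Union>w\<in>W. word_map f w ` H)"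
    proof -
      have "(\<Union>w\<in>W. word_map f w ` H) = (\<Union>k\<in>{1..M}. f k ` (\<Union>w\<in>V k. word_map f w ` H))"
        unfolding W_def by (auto simp: word_map_Cons)
      also have "\<dots> = (\<Union>k\<in>{1..M}. f k ` H)" using V by (intro SUP_cong) auto
      finally show ?thesis using H by simp
    qed
    ultimately show ?thesis by blast
  qed
qed

section \<open>Counting pieces near a point\<close>

text \<open>Half the diameter is an admissible radius; finitely many balls of this radius cover \<open>H\<close>, and a single one
already has mass at least \<open>a * diameter H / 2\<close>.\<close>

lemma ahlfors_regular_total_mass:
  assumes ahl: "ahlfors_regular_1 a b H" and H: "compact H" "H \<noteq> {}" and D: "0 < diameter H"
  shows "\<exists>m. hausdorff_measure 1 H = ennreal m \<and> a * diameter H / 2 \<le> m"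
proof -
  define R where "R = diameter H / 2"
  have R: "R \<in> {0<..<diameter H}" using D by (simp add: R_def)
  have ab: "0 < a" "0 < b" using ahl by (auto simp: ahlfors_regular_1_def)
  have A: "ennreal (a * R) \<le> hausdorff_measure 1 (H \<inter> ball x R)"
    "hausdorff_measure 1 (H \<inter> ball x R) \<le> ennreal (b * R)" if "x \<in> H" for x
    using ahl R that by (auto simp: ahlfors_regular_1_def)
  obtain X where X: "finite X" "X \<subseteq> H" "H \<subseteq> (\<Union>x\<in>X. ball x R)"
  proof (rule compactE_image[OF H(1), of H "\<lambda>x. ball x R"])
    show "H \<subseteq> (\<Union>x\<in>H. ball x R)" using R by force
  qed auto
  have "H = (\<Union>x\<in>X. H \<inter> ball x R)" using X by blast
  then have "hausdorff_measure 1 H \<le> (\<Sum>x\<in>X. hausdorff_measure 1 (H \<inter> ball x R))"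
    using hausdorff_measure_UN_le[OF X(1), of 1 "\<lambda>x. H \<inter> ball x R"] by metis
  also have "\<dots> \<le> (\<Sum>x\<in>X. ennreal (b * R))" using A X by (intro sum_mono) auto
  also have "\<dots> < top" by (simp add: less_top[symmetric] ennreal_mult_eq_top_iff)
  finally obtain m where m: "0 \<le> m" "hausdorff_measure 1 H = ennreal m" by (metis less_top_ennreal)
  obtain x where "x \<in> H" using H by blast
  then have "ennreal (a * R) \<le> hausdorff_measure 1 H"
    using A(1) hausdorff_measure_mono[of "H \<inter> ball x R" H] by (meson inf_le1 order_trans)
  then have "a * R \<le> m" using m by simp
  then show ?thesis using m by (auto simp: R_def)
qed

text \<open>The pieces outside \<open>F\<close> have mass at most \<open>m\<close> times their total ratio, and the total ratio of all pieces is 1.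
Subadditivity therefore leaves at least this much mass for the pieces in \<open>F\<close>; in effect the pieces
behave as if they were disjoint.\<close>

lemma mass_of_pieces_ge:
  assumes W: "finite W" "H = (\<Union>w\<in>W. g w ` H)" "(\<Sum>w\<in>W. \<rho> w) = 1"
    and g: "\<And>w x y. w \<in> W \<Longrightarrow> dist (g w x) (g w y) \<le> \<rho> w * dist x y" "\<And>w. w \<in> W \<Longrightarrow> 0 < \<rho> w"
    and m: "hausdorff_measure 1 (H :: 'a::real_normed_vector set) = ennreal m" "0 \<le> m" and F: "F \<subseteq> W"
  shows "ennreal (m * (\<Sum>w\<in>F. \<rho> w)) \<le> hausdorff_measure 1 (\<Union>w\<in>F. g w ` H)"
proof (cases "hausdorff_measure 1 (\<Union>w\<in>F. g w ` H) = top")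
  case False
  then obtain x where x: "0 \<le> x" "hausdorff_measure 1 (\<Union>w\<in>F. g w ` H) = ennreal x"
    by (metis ennreal_cases infinity_ennreal_def)
  have pos: "0 \<le> (\<Sum>w\<in>W - F. \<rho> w)" using g(2) by (intro sum_nonneg) (auto intro: less_imp_le)
  have "(\<Union>w\<in>W. g w ` H) = (\<Union>w\<in>F. g w ` H) \<union> (\<Union>w\<in>W - F. g w ` H)" using F by blast
  then have "H = (\<Union>w\<in>F. g w ` H) \<union> (\<Union>w\<in>W - F. g w ` H)" unfolding W(2)[symmetric] .
  then have "ennreal m \<le> ennreal x + hausdorff_measure 1 (\<Union>w\<in>W - F. g w ` H)"
    using hausdorff_measure_Un_le[of 1 "\<Union>w\<in>F. g w ` H" "\<Union>w\<in>W - F. g w ` H"] m(1) x(2) by metis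
  also have "hausdorff_measure 1 (\<Union>w\<in>W - F. g w ` H) \<le> (\<Sum>w\<in>W - F. hausdorff_measure 1 (g w ` H))"
    using W(1) by (intro hausdorff_measure_UN_le) auto
  also have "\<dots> \<le> (\<Sum>w\<in>W - F. ennreal (\<rho> w) * ennreal m)"
    unfolding m(1)[symmetric] using g by (intro sum_mono hausdorff_measure_1_lipschitz_image) auto
  also have "\<dots> = ennreal (\<Sum>w\<in>W - F. \<rho> w * m)"
    using g(2) m(2) by (subst sum_ennreal[symmetric]) (auto simp: ennreal_mult less_imp_le)
  also have "(\<Sum>w\<in>W - F. \<rho> w * m) = (\<Sum>w\<in>W - F. \<rho> w) * m" by (rule sum_distrib_right[symmetric])
  finally have "ennreal m \<le> ennreal (x + (\<Sum>w\<in>W - F. \<rho> w) * m)"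
    using x m pos by (simp add: add_left_mono)
  then have "m \<le> x + (\<Sum>w\<in>W - F. \<rho> w) * m" using x m pos by (subst (asm) ennreal_le_iff) auto
  moreover have "(\<Sum>w\<in>W - F. \<rho> w) = 1 - (\<Sum>w\<in>F. \<rho> w)" using sum_diff[OF W(1) F, of \<rho>] W(3) by simp
  ultimately have "m * (\<Sum>w\<in>F. \<rho> w) \<le> x" by (simp add: algebra_simps)
  then show ?thesis using x by (simp add: ennreal_leI)
qed simp

text \<open>All the pieces counted lie in one ball of radius comparable to \<open>t * diameter H\<close>. By \<open>mass_of_pieces_ge\<close> their
number times \<open>\<rho>\<^sub>0\<close> is bounded by the mass of that ball, hence by upper regularity. If the ball is as large
as \<open>H\<close>, the trivial bound \<open>1 / \<rho>\<^sub>0\<close> on the number of all pieces is good enough.\<close>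

lemma card_pieces_near_point:
  assumes ahl: "ahlfors_regular_1 a b H" and H: "compact H" "H \<noteq> {}" and D: "0 < diameter H"
    and W: "finite W" "H = (\<Union>w\<in>W. g w ` H)" "(\<Sum>w\<in>W. \<rho> w) = 1"
    and g: "\<And>w x y. w \<in> W \<Longrightarrow> dist (g w x) (g w y) = \<rho> w * dist x y" "\<And>w. w \<in> W \<Longrightarrow> 0 < \<rho> w"
    and C: "C \<subseteq> W" "\<And>w. w \<in> C \<Longrightarrow> \<rho> w = \<rho>\<^sub>0" and h: "h \<in> H" and w0: "w0 \<in> C"
    and t: "\<rho>\<^sub>0 \<le> t"
  shows "real (card {w \<in> C. dist (g w h) (g w0 h) \<le> t * diameter (H :: 'a::real_normed_vector set)}) \<le> (6 * b / a + 3) * t / \<rho>\<^sub>0"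
proof -
  define D where "D = diameter H"
  define F where "F = {w \<in> C. dist (g w h) (g w0 h) \<le> t * D}"
  have D0: "0 < D" using assms(4) by (simp add: D_def)
  have ab: "0 < a" "0 < b" using ahl by (auto simp: ahlfors_regular_1_def)
  have \<rho>0: "0 < \<rho>\<^sub>0" using C(2)[OF w0] g(2) C(1) w0 by force
  have FW: "F \<subseteq> W" using C by (auto simp: F_def)
  have Fsum: "(\<Sum>w\<in>F. \<rho> w) = real (card F) * \<rho>\<^sub>0" using C(2) by (simp add: F_def)
  obtain m where m: "hausdorff_measure 1 H = ennreal m" "a * D / 2 \<le> m"
    using ahlfors_regular_total_mass[OF ahl H] assms(4) unfolding D_def by blast
  have m0: "0 < m" using m(2) ab D0 by (smt (verit) half_gt_zero_iff mult_pos_pos)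
  have gH: "g w x \<in> H" if "w \<in> W" "x \<in> H" for w x
  proof -
    have "g w x \<in> (\<Union>w\<in>W. g w ` H)" using that by blast
    then show ?thesis unfolding W(2)[symmetric] .
  qed
  define R where "R = (t + 2 * \<rho>\<^sub>0) * D"
  have near: "(\<Union>w\<in>F. g w ` H) \<subseteq> H \<inter> ball (g w0 h) R"
  proof
    fix y assume "y \<in> (\<Union>w\<in>F. g w ` H)"
    then obtain w x where wx: "w \<in> F" "x \<in> H" "y = g w x" by blast
    have "dist y (g w h) = \<rho>\<^sub>0 * dist x h" using g(1)[of w x h] wx FW C(2)[of w] by (auto simp: F_def)
    also have "\<dots> \<le> \<rho>\<^sub>0 * D"
      unfolding D_def using \<rho>0 wx h H by (intro mult_left_mono diameter_bounded_bound) (auto intro: compact_imp_bounded)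
    finally have "dist y (g w0 h) \<le> \<rho>\<^sub>0 * D + t * D"
      using wx(1) dist_triangle[of y "g w0 h" "g w h"] by (auto simp: F_def)
    also have "\<dots> < R" using \<rho>0 D0 by (simp add: R_def algebra_simps)
    finally show "y \<in> H \<inter> ball (g w0 h) R" using gH wx FW by (auto simp: dist_commute)
  qed
  have "real (card F) \<le> (6 * b / a + 3) * t / \<rho>\<^sub>0"
  proof (cases "R < D")
    case True
    have R0: "0 < R" using \<rho>0 t D0 by (simp add: R_def)
    have "ennreal (m * (real (card F) * \<rho>\<^sub>0)) \<le> hausdorff_measure 1 (\<Union>w\<in>F. g w ` H)"
      unfolding Fsum[symmetric] using g m m0 FW by (intro mass_of_pieces_ge[OF W]) auto
    also have "\<dots> \<le> hausdorff_measure 1 (H \<inter> ball (g w0 h) R)" by (rule hausdorff_measure_mono[OF near])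
    also have "\<dots> \<le> ennreal (b * R)"
      using ahl R0 True gH w0 C h unfolding ahlfors_regular_1_def D_def by auto
    finally have le: "m * (real (card F) * \<rho>\<^sub>0) \<le> b * R" using ab R0 by (simp add: ennreal_le_iff)
    have "a * D / 2 * (real (card F) * \<rho>\<^sub>0) \<le> m * (real (card F) * \<rho>\<^sub>0)"
      using m(2) \<rho>0 by (intro mult_right_mono) auto
    also have "\<dots> \<le> b * (3 * t * D)"
    proof -
      have "R \<le> 3 * t * D" unfolding R_def using t D0 by (intro mult_right_mono) auto
      then have "b * R \<le> b * (3 * t * D)" using ab by (intro mult_left_mono) auto
      then show ?thesis using le by linarith
    qed
    finally have "D * (a * (real (card F) * \<rho>\<^sub>0)) \<le> D * (6 * b * t)" by (simp add: algebra_simps)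
    then have "a * (real (card F) * \<rho>\<^sub>0) \<le> 6 * b * t" using D0 by simp
    then have "real (card F) \<le> 6 * b / a * t / \<rho>\<^sub>0" using ab \<rho>0 by (simp add: field_simps)
    also have "\<dots> \<le> (6 * b / a + 3) * t / \<rho>\<^sub>0" using \<rho>0 t by (intro divide_right_mono mult_right_mono) auto
    finally show ?thesis .
  next
    case False
    then have "1 \<le> t + 2 * \<rho>\<^sub>0" using D0 by (simp add: R_def)
    then have t3: "1 \<le> 3 * t" using t by linarith
    have "real (card F) * \<rho>\<^sub>0 \<le> (\<Sum>w\<in>W. \<rho> w)"
      unfolding Fsum[symmetric] using W(1) FW g(2) by (intro sum_mono2) (auto intro: less_imp_le)
    then have "real (card F) * \<rho>\<^sub>0 \<le> 3 * t" using W(3) t3 by linarith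
    then have "real (card F) \<le> 3 * t / \<rho>\<^sub>0" using \<rho>0 by (simp add: field_simps)
    also have "\<dots> \<le> (6 * b / a + 3) * t / \<rho>\<^sub>0"
      using \<rho>0 t ab by (intro divide_right_mono mult_right_mono) auto
    finally show ?thesis .
  qed
  then show ?thesis by (simp add: F_def D_def)
qed


section \<open>Overlaps of projections averaged over directions\<close>

text \<open>A continuous substitute for the indicator function of \<open>\<bar>u\<bar> \<le> \<eta>\<close>; continuity is needed in
\<open>exists_orbit_with_bounded_averages\<close>.\<close>

definition bump :: "real \<Rightarrow> real \<Rightarrow> real" where
  "bump \<eta> u = max 0 (2 - \<bar>u\<bar> / \<eta>)"

lemma bump_nonneg: "0 \<le> bump \<eta> u"
  by (simp add: bump_def)

lemma bump_le_2: "0 < \<eta> \<Longrightarrow> bump \<eta> u \<le> 2"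
  by (simp add: bump_def)

lemma bump_ge_1: "0 < \<eta> \<Longrightarrow> \<bar>u\<bar> \<le> \<eta> \<Longrightarrow> 1 \<le> bump \<eta> u"
  by (simp add: bump_def le_max_iff_disj)

lemma bump_eq_0: "0 < \<eta> \<Longrightarrow> 2 * \<eta> < \<bar>u\<bar> \<Longrightarrow> bump \<eta> u = 0"
  by (simp add: bump_def max_def field_simps)

text \<open>Two points at distance \<open>u\<close> have projections within \<open>6 * \<rho> * D\<close> of each other only for a proportion of order
\<open>\<rho> * D / u\<close> of all directions. The grid has at least \<open>1 / \<rho>\<close> directions, so that the additive 1 in the count is
absorbed.\<close>

lemma grid_sum_bump_le:
  assumes \<sigma>: "\<sigma> = 1 \<or> \<sigma> = -1" and Q: "1 \<le> real Q * \<rho>" and \<rho>: "0 < \<rho>" and D: "0 < D"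
    and v: "norm v \<le> D"
  shows "(\<Sum>j<Q. bump (3 * \<rho> * D) (angle_proj (c + \<sigma> * pi * real j / real Q) v))
    \<le> 26 * real Q * (if norm v \<le> \<rho> * D then 1 else \<rho> * D / norm v)"
proof -
  have Q0: "0 < Q" using Q by (cases Q) auto
  have \<eta>: "0 < 3 * \<rho> * D" using \<rho> D by simp
  show ?thesis
  proof (cases "norm v \<le> \<rho> * D")
    case True
    have "(\<Sum>j<Q. bump (3 * \<rho> * D) (angle_proj (c + \<sigma> * pi * real j / real Q) v)) \<le> (\<Sum>j<Q. 2)"
      using bump_le_2[OF \<eta>] by (intro sum_mono) auto
    then show ?thesis using True by simp
  next
    case False
    then have v0: "0 < norm v" using \<rho> D by (smt (verit) mult_pos_pos)
    obtain \<beta> where \<beta>: "\<And>\<theta>. angle_proj \<theta> v = norm v * cos (\<theta> - \<beta>)" using angle_proj_polar[of v] by blast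
    define t where "t = 6 * \<rho> * D / norm v"
    have t0: "0 \<le> t" using \<rho> D by (simp add: t_def)
    define J where "J = {j. j < Q \<and> \<bar>cos ((c - \<beta>) + \<sigma> * pi * real j / real Q)\<bar> \<le> t}"
    have J: "finite J" "J \<subseteq> {..<Q}" by (auto simp: J_def)
    have zero: "bump (3 * \<rho> * D) (angle_proj (c + \<sigma> * pi * real j / real Q) v) = 0" if "j < Q" "j \<notin> J" for j
    proof (rule bump_eq_0[OF \<eta>])
      have "t < \<bar>cos (c + \<sigma> * pi * real j / real Q - \<beta>)\<bar>" using that by (simp add: J_def algebra_simps)
      then have "norm v * t < \<bar>angle_proj (c + \<sigma> * pi * real j / real Q) v\<bar>"
        unfolding \<beta> abs_mult using v0 by simp
      then show "2 * (3 * \<rho> * D) < \<bar>angle_proj (c + \<sigma> * pi * real j / real Q) v\<bar>"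
        using v0 by (simp add: t_def)
    qed
    have "(\<Sum>j<Q. bump (3 * \<rho> * D) (angle_proj (c + \<sigma> * pi * real j / real Q) v))
        = (\<Sum>j\<in>J. bump (3 * \<rho> * D) (angle_proj (c + \<sigma> * pi * real j / real Q) v))"
      using J zero by (intro sum.mono_neutral_right) auto
    also have "\<dots> \<le> (\<Sum>j\<in>J. 2)" using bump_le_2[OF \<eta>] by (intro sum_mono) auto
    also have "\<dots> \<le> 2 * (2 * real Q * t + 1)"
      using card_grid_small_cos[OF \<sigma> Q0 t0, of "c - \<beta>"] unfolding J_def by simp
    also have "1 \<le> real Q * (\<rho> * D / norm v)"
    proof -
      have "\<rho> \<le> \<rho> * D / norm v" using v v0 \<rho> by (simp add: field_simps)
      then have "real Q * \<rho> \<le> real Q * (\<rho> * D / norm v)" by (intro mult_left_mono) auto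
      then show ?thesis using Q by linarith
    qed
    finally show ?thesis using False by (simp add: t_def algebra_simps)
  qed
qed

text \<open>The term for the least \<open>i\<close> with \<open>u \<le> 2 ^ i * e\<close> alone suffices.\<close>

lemma truncated_inverse_le_dyadic_sum:
  fixes u e :: real
  assumes e: "0 < e" and u: "u \<le> 2 ^ J * e"
  shows "(if u \<le> e then 1 else e / u) \<le> (\<Sum>i\<le>J. 2 / 2 ^ i * of_bool (u \<le> 2 ^ i * e))"
proof -
  define n where "n = (LEAST i. u \<le> 2 ^ i * e)"
  have n: "u \<le> 2 ^ n * e" unfolding n_def by (rule LeastI[of _ J]) (rule u)
  have nJ: "n \<le> J" unfolding n_def by (rule Least_le) (rule u)
  have "(if u \<le> e then 1 else e / u) \<le> 2 / 2 ^ n"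
  proof (cases n)
    case 0
    then show ?thesis using n e by auto
  next
    case (Suc k)
    then have k: "2 ^ k * e < u" using not_less_Least[of k "\<lambda>i. u \<le> 2 ^ i * e"] by (auto simp: n_def)
    have "1 * e \<le> 2 ^ k * e" using e by (intro mult_right_mono) auto
    then have ue: "e < u" using k by linarith
    have "e / u \<le> 1 / 2 ^ k" using k ue e by (simp add: field_simps)
    then show ?thesis using ue Suc by simp
  qed
  also have "\<dots> = (\<Sum>i\<in>{n}. 2 / 2 ^ i * of_bool (u \<le> 2 ^ i * e))" using n by simp
  also have "\<dots> \<le> (\<Sum>i\<le>J. 2 / 2 ^ i * of_bool (u \<le> 2 ^ i * e))"
    using nJ by (intro sum_mono2) auto
  finally show ?thesis .
qed

text \<open>A smoothed average number of pieces whose projections in direction \<open>\<theta>\<close> come close to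
that of a given piece.\<close>

definition overlap_average :: "'w set \<Rightarrow> ('w \<Rightarrow> real^2) \<Rightarrow> real \<Rightarrow> real \<Rightarrow> real" where
  "overlap_average C x \<eta> \<theta> =
     (\<Sum>w\<in>C. \<Sum>w'\<in>C. bump \<eta> (angle_proj \<theta> (x w - x w'))) / real (card C)"

lemma overlap_average_nonneg: "0 \<le> overlap_average C x \<eta> \<theta>"
  unfolding overlap_average_def by (intro divide_nonneg_nonneg sum_nonneg bump_nonneg) auto

lemma overlap_average_pos:
  assumes "finite C" "C \<noteq> {}" "0 < \<eta>" shows "0 < overlap_average C x \<eta> \<theta>"
proof -
  obtain w where w: "w \<in> C" using assms by blast
  have "0 < bump \<eta> (angle_proj \<theta> (x w - x w))" using assms(3) by (simp add: bump_def angle_proj_def)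
  then have row: "0 < (\<Sum>w'\<in>C. bump \<eta> (angle_proj \<theta> (x w - x w')))"
    by (rule sum_pos2[OF assms(1) w]) (rule bump_nonneg)
  have "0 < (\<Sum>w\<in>C. \<Sum>w'\<in>C. bump \<eta> (angle_proj \<theta> (x w - x w')))"
    by (rule sum_pos2[OF assms(1) w]) (rule row, intro sum_nonneg bump_nonneg)
  then show ?thesis using assms by (simp add: overlap_average_def card_gt_0_iff)
qed

lemma overlap_average_periodic: "overlap_average C x \<eta> (\<theta> + pi) = overlap_average C x \<eta> \<theta>"
  by (simp add: overlap_average_def angle_proj_plus_pi bump_def)

lemma continuous_overlap_average: "0 < \<eta> \<Longrightarrow> continuous_on UNIV (overlap_average C x \<eta>)"
  unfolding overlap_average_def bump_def angle_proj_def divide_inverse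
  by (intro continuous_intros)

text \<open>For a fixed piece, the \<open>J + 1\<close> dyadic ranges of distances are all bounded by the same amount: twice as
far away there are at most twice as many pieces, each meeting the given one in half as many directions.
Thus the overlap is only of order \<open>log (1/\<rho>)\<close> in the mean, while the number of pieces is a power of
\<open>1/\<rho>\<close>. This is the usual estimate of an energy with the kernel \<open>1 / dist\<close>.\<close>

lemma grid_sum_overlap_average_le:
  assumes C: "finite C" "C \<noteq> {}" and \<rho>: "0 < \<rho>" and D: "0 < D" and B: "0 \<le> B"
    and dist: "\<And>w w'. \<lbrakk>w \<in> C; w' \<in> C\<rbrakk> \<Longrightarrow> dist (x w') (x w) \<le> D"
    and count: "\<And>w t. \<lbrakk>w \<in> C; \<rho> \<le> t\<rbrakk> \<Longrightarrow> real (card {w' \<in> C. dist (x w') (x w) \<le> t * D}) \<le> B * t / \<rho>"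
    and J: "1 \<le> 2 ^ J * \<rho>" and \<sigma>: "\<sigma> = 1 \<or> \<sigma> = -1" and Q: "1 \<le> real Q * \<rho>"
  shows "(\<Sum>j<Q. overlap_average C x (3 * \<rho> * D) (c + \<sigma> * pi * real j / real Q))
    \<le> real Q * (52 * B * (real J + 1))"
proof -
  have row: "(\<Sum>w'\<in>C. \<Sum>j<Q. bump (3 * \<rho> * D) (angle_proj (c + \<sigma> * pi * real j / real Q) (x w - x w')))
      \<le> real Q * (52 * B * (real J + 1))" if w: "w \<in> C" for w
  proof -
    have "(\<Sum>w'\<in>C. \<Sum>j<Q. bump (3 * \<rho> * D) (angle_proj (c + \<sigma> * pi * real j / real Q) (x w - x w')))
        \<le> (\<Sum>w'\<in>C. 26 * real Q * (\<Sum>i\<le>J. 2 / 2 ^ i * of_bool (dist (x w') (x w) \<le> 2 ^ i * \<rho> * D)))"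
    proof (rule sum_mono)
      fix w' assume w': "w' \<in> C"
      define u where "u = norm (x w - x w')"
      have u: "u = dist (x w') (x w)" by (simp add: u_def dist_norm norm_minus_commute)
      have uD: "u \<le> D" using dist[OF w w'] by (simp add: u)
      have "u \<le> 2 ^ J * (\<rho> * D)" using uD mult_right_mono[OF J, of D] D unfolding mult.assoc by linarith
      then have "(if u \<le> \<rho> * D then 1 else \<rho> * D / u) \<le> (\<Sum>i\<le>J. 2 / 2 ^ i * of_bool (u \<le> 2 ^ i * (\<rho> * D)))"
        using \<rho> D by (intro truncated_inverse_le_dyadic_sum) auto
      then have "26 * real Q * (if u \<le> \<rho> * D then 1 else \<rho> * D / u)
          \<le> 26 * real Q * (\<Sum>i\<le>J. 2 / 2 ^ i * of_bool (u \<le> 2 ^ i * (\<rho> * D)))"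
        by (intro mult_left_mono) auto
      then show "(\<Sum>j<Q. bump (3 * \<rho> * D) (angle_proj (c + \<sigma> * pi * real j / real Q) (x w - x w')))
          \<le> 26 * real Q * (\<Sum>i\<le>J. 2 / 2 ^ i * of_bool (dist (x w') (x w) \<le> 2 ^ i * \<rho> * D))"
        using grid_sum_bump_le[OF \<sigma> Q \<rho> D uD[unfolded u_def], of c]
        unfolding u_def[symmetric] u[symmetric] by (simp add: mult.assoc)
    qed
    also have "\<dots> = 26 * real Q * (\<Sum>i\<le>J. 2 / 2 ^ i * real (card {w' \<in> C. dist (x w') (x w) \<le> 2 ^ i * \<rho> * D}))"
    proof -
      have "(\<Sum>w'\<in>C. \<Sum>i\<le>J. (2 :: real) / 2 ^ i * of_bool (dist (x w') (x w) \<le> 2 ^ i * \<rho> * D))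
          = (\<Sum>i\<le>J. 2 / 2 ^ i * (\<Sum>w'\<in>C. of_bool (dist (x w') (x w) \<le> 2 ^ i * \<rho> * D)))"
        by (subst sum.swap) (simp add: sum_distrib_left)
      also have "\<dots> = (\<Sum>i\<le>J. 2 / 2 ^ i * real (card {w' \<in> C. dist (x w') (x w) \<le> 2 ^ i * \<rho> * D}))"
        using C(1) by (simp add: sum_of_bool_eq Int_def)
      finally show ?thesis by (simp flip: sum_distrib_left)
    qed
    also have "\<dots> \<le> 26 * real Q * (\<Sum>i\<le>J. 2 * B)"
    proof (intro mult_left_mono sum_mono)
      fix i
      have "\<rho> \<le> 2 ^ i * \<rho>" using \<rho> by simp
      then have "real (card {w' \<in> C. dist (x w') (x w) \<le> 2 ^ i * \<rho> * D}) \<le> B * (2 ^ i * \<rho>) / \<rho>"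
        by (rule count[OF w])
      also have "\<dots> = B * 2 ^ i" using \<rho> by simp
      finally have "2 / 2 ^ i * real (card {w' \<in> C. dist (x w') (x w) \<le> 2 ^ i * \<rho> * D}) \<le> 2 / 2 ^ i * (B * 2 ^ i)"
        by (intro mult_left_mono) auto
      then show "2 / 2 ^ i * real (card {w' \<in> C. dist (x w') (x w) \<le> 2 ^ i * \<rho> * D}) \<le> 2 * B" by simp
    qed auto
    finally show ?thesis by (simp add: algebra_simps)
  qed
  have cC: "0 < real (card C)" using C by (simp add: card_gt_0_iff)
  have "(\<Sum>j<Q. overlap_average C x (3 * \<rho> * D) (c + \<sigma> * pi * real j / real Q))
      = (\<Sum>w\<in>C. \<Sum>w'\<in>C. \<Sum>j<Q. bump (3 * \<rho> * D) (angle_proj (c + \<sigma> * pi * real j / real Q) (x w - x w'))) / real (card C)"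
    unfolding overlap_average_def sum_divide_distrib[symmetric]
    by (subst sum.swap, intro arg_cong2[where f = "(/)"] sum.cong refl, subst sum.swap) simp
  also have "\<dots> \<le> (\<Sum>w\<in>C. real Q * (52 * B * (real J + 1))) / real (card C)"
    using cC row by (intro divide_right_mono sum_mono) auto
  also have "\<dots> = real Q * (52 * B * (real J + 1))" using cC by simp
  finally show ?thesis .
qed

lemma exists_separated_subset:
  assumes C: "finite C" "C \<noteq> {}" and \<eta>: "0 < \<eta>"
  shows "\<exists>S\<subseteq>C. (\<forall>w\<in>S. \<forall>w'\<in>S. w \<noteq> w' \<longrightarrow> \<eta> < \<bar>angle_proj \<theta> (x w - x w')\<bar>) \<and>
    real (card C) \<le> 4 * overlap_average C x \<eta> \<theta> * real (card S)"
proof -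
  define R where "R w w' \<longleftrightarrow> \<bar>angle_proj \<theta> (x w - x w')\<bar> \<le> \<eta>" for w w'
  have cC: "0 < real (card C)" using C by (simp add: card_gt_0_iff)
  have "(\<Sum>w\<in>C. real (card {w'\<in>C. R w w'})) \<le> (\<Sum>w\<in>C. \<Sum>w'\<in>C. bump \<eta> (angle_proj \<theta> (x w - x w')))"
  proof (rule sum_mono)
    fix w
    have "real (card {w'\<in>C. R w w'}) = (\<Sum>w'\<in>C. of_bool (R w w'))"
      using C(1) by (simp add: sum_of_bool_eq Int_def)
    also have "\<dots> \<le> (\<Sum>w'\<in>C. bump \<eta> (angle_proj \<theta> (x w - x w')))"
      using bump_ge_1[OF \<eta>] bump_nonneg by (intro sum_mono) (auto simp: R_def)
    finally show "real (card {w'\<in>C. R w w'}) \<le> (\<Sum>w'\<in>C. bump \<eta> (angle_proj \<theta> (x w - x w')))" .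
  qed
  also have "\<dots> = real (card C) * overlap_average C x \<eta> \<theta>"
    using cC by (simp add: overlap_average_def)
  finally have deg: "(\<Sum>w\<in>C. real (card {w'\<in>C. R w w'})) \<le> real (card C) * overlap_average C x \<eta> \<theta>" .
  have "\<exists>S\<subseteq>C. (\<forall>w\<in>S. \<forall>w'\<in>S. w \<noteq> w' \<longrightarrow> \<not> R w w') \<and>
      real (card C) \<le> 4 * overlap_average C x \<eta> \<theta> * real (card S)"
  proof (rule exists_independent_subset[OF C(1) _ _ deg overlap_average_pos[OF C \<eta>]])
    show "R w' w" if "R w w'" for w w'
      using that by (simp add: R_def angle_proj_diff abs_minus_commute)
    show "R w w" for w using \<eta> by (simp add: R_def angle_proj_def)
  qed
  then show ?thesis by (simp add: R_def not_le)
qed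

text \<open>The inequality of the means, from \<open>F i \<le> L * exp (F i / L - 1)\<close>. It turns the bound on the average
overlap along an orbit into a bound on the product over the stages.\<close>

lemma prod_le_power_of_average_le:
  fixes F :: "nat \<Rightarrow> real"
  assumes F: "\<And>i. 0 \<le> F i" and L: "0 < L" and avg: "(\<Sum>i<k. F i) \<le> real k * L"
  shows "(\<Prod>i<k. F i) \<le> L ^ k"
proof -
  have "(\<Prod>i<k. F i) \<le> (\<Prod>i<k. L * exp (F i / L - 1))"
  proof (rule prod_mono, intro conjI F)
    fix i
    have "F i = L * (1 + (F i / L - 1))" using L by simp
    also have "\<dots> \<le> L * exp (F i / L - 1)" using L by (intro mult_left_mono exp_ge_add_one_self) auto
    finally show "F i \<le> L * exp (F i / L - 1)" .
  qed
  also have "\<dots> = L ^ k * exp (\<Sum>i<k. F i / L - 1)" by (simp add: prod.distrib exp_sum)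
  also have "(\<Sum>i<k. F i / L - 1) = (\<Sum>i<k. F i) / L - real k"
    by (simp add: sum_subtractf sum_divide_distrib)
  also have "L ^ k * exp ((\<Sum>i<k. F i) / L - real k) \<le> L ^ k * 1"
    using avg L by (intro mult_left_mono) (auto simp: field_simps)
  finally show ?thesis by simp
qed


section \<open>The graph at a given scale\<close>

lemma diameter_convex_hull:
  fixes H :: "'a::real_normed_vector set"
  assumes H: "bounded H" "H \<noteq> {}"
  shows "diameter (convex hull H) = diameter H"
proof (rule antisym)
  have 1: "convex hull H \<subseteq> cball x (diameter H)" if "x \<in> H" for x
    using that H by (intro hull_minimal) (auto intro: diameter_bounded_bound)
  have 2: "convex hull H \<subseteq> cball y (diameter H)" if y: "y \<in> convex hull H" for y
    using 1 y by (intro hull_minimal) (auto simp: dist_commute subset_iff)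
  show "diameter (convex hull H) \<le> diameter H"
  proof (rule diameter_le)
    show "convex hull H \<noteq> {} \<or> 0 \<le> diameter H" using H by simp
    show "norm (x - y) \<le> diameter H" if "x \<in> convex hull H" "y \<in> convex hull H" for x y
      using 2[OF that(1)] that(2) by (auto simp: dist_norm)
  qed
  show "diameter H \<le> diameter (convex hull H)"
    using H by (intro diameter_subset hull_subset bounded_convex_hull)
qed

lemma nondegenerate_diameter_pos:
  assumes "nondegenerate \<nu> H" "compact H" "H \<noteq> {}" shows "0 < diameter H"
proof (rule ccontr)
  assume "\<not> 0 < diameter H"
  then have "dist x y \<le> 0" if "x \<in> H" "y \<in> H" for x y
    using diameter_bounded_bound[OF compact_imp_bounded[OF assms(2)] that] by linarith
  moreover obtain h where h: "h \<in> H" using assms(3) by blast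
  ultimately have "H = {h}" by auto
  then have "min_width (convex hull H) = 0" by (simp add: min_width_def)
  then show False using assms(1) by (auto simp: nondegenerate_def)
qed

lemma lipschitz_graph_of_cone_condition:
  assumes L: "0 \<le> L" and cone: "\<And>x y. \<lbrakk>x \<in> E; y \<in> E\<rbrakk> \<Longrightarrow> dist x y \<le> L * \<bar>angle_proj \<theta> x - angle_proj \<theta> y\<bar>"
  shows "\<exists>T g. is_lipschitz_graph E \<theta> T g \<and> lip_const g T \<le> L"
proof -
  define T where "T = angle_proj \<theta> ` E"
  define g where "g t = angle_proj (\<theta> + pi/2) (inv_into E (angle_proj \<theta>) t)" for t
  have inj: "inj_on (angle_proj \<theta>) E" using cone by (fastforce intro: inj_onI)
  have g: "g (angle_proj \<theta> x) = angle_proj (\<theta> + pi/2) x" if "x \<in> E" for x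
    using that inj by (simp add: g_def)
  have "L-lipschitz_on T g"
  proof (rule lipschitz_onI[OF _ L])
    fix t t' assume "t \<in> T" "t' \<in> T"
    then obtain x y where xy: "x \<in> E" "y \<in> E" "t = angle_proj \<theta> x" "t' = angle_proj \<theta> y" by (auto simp: T_def)
    have "dist (g t) (g t') = \<bar>angle_proj (\<theta> + pi/2) (x - y)\<bar>"
      by (simp add: xy g dist_real_def angle_proj_diff)
    also have "\<dots> \<le> dist x y" unfolding dist_norm by (rule abs_angle_proj_le)
    also have "\<dots> \<le> L * dist t t'" using cone xy by (simp add: dist_real_def)
    finally show "dist (g t) (g t') \<le> L * dist t t'" .
  qed
  moreover have "E = (\<lambda>t. t *\<^sub>R vector [cos \<theta>, sin \<theta>] + g t *\<^sub>R vector [- sin \<theta>, cos \<theta>]) ` T"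
  proof -
    have "(\<lambda>t. t *\<^sub>R vector [cos \<theta>, sin \<theta>] + g t *\<^sub>R vector [- sin \<theta>, cos \<theta>]) (angle_proj \<theta> x) = x" if "x \<in> E" for x
      using angle_proj_decompose[of x \<theta>] g[OF that] by simp
    then show ?thesis unfolding T_def image_image by simp
  qed
  moreover have "bdd_below {L. L-lipschitz_on T g}"
    by (intro bdd_belowI[of _ 0]) (auto dest: lipschitz_on_nonneg)
  ultimately show ?thesis
    unfolding is_lipschitz_graph_def lip_const_def by (blast intro: cInf_lower)
qed

text \<open>The choice of scale is \<open>log (1/\<rho>) = 15 M E log E\<close> with \<open>E = 1/\<epsilon>\<close>. Then \<open>\<rho> powr -\<epsilon> = E ^ (15 M)\<close>,
whereas the losses to be compensated are polynomial in \<open>log (1/\<rho>) \<le> 15 M E\<^sup>2\<close>: the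
number of linear parts has degree \<open>2 M\<close> and the mean overlap degree 1, which makes \<open>E ^ (4 M + 2)\<close>
up to a constant. One more power of \<open>E\<close> beats that constant, and \<open>4 M + 3 \<le> 15 M\<close>. The difference between the constants
20 and 15 absorbs \<open>lo\<close> and \<open>D\<close>.\<close>

lemma scale_parameters_exist:
  assumes M: "1 \<le> M" and lo: "0 < lo" "lo \<le> 1" and hi: "0 < hi" "hi < 1" and B: "0 \<le> B" and D: "0 < D"
  shows "\<exists>e0. 0 < e0 \<and> e0 < 1 \<and> (\<forall>\<epsilon>\<in>{0<..e0}. \<exists>N J \<rho>. 0 < \<rho> \<and> \<rho> < 1 \<and> hi ^ N \<le> \<rho> \<and> 1 \<le> 2 ^ J * (lo * \<rho>) \<and>
     8 * ((real N + 1) * (2 * real N + 1)) ^ M * (52 * B * (real J + 1) + 1) \<le> \<rho> powr - \<epsilon> \<and>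
     1 / (lo * \<rho>) \<le> D * exp (20 * real M * (1 / \<epsilon>) * ln (1 / \<epsilon>)))"
proof -
  define l1 where "l1 = ln (1 / hi)"
  define l2 where "l2 = ln (1 / lo)"
  have l1: "0 < l1" using hi by (simp add: l1_def)
  have l2: "0 \<le> l2" using lo by (simp add: l2_def)
  define c1 where "c1 = 2 / l1 + 3"
  define c2 where "c2 = 52 * B * ((1 + l2) / ln 2 + 2) + 1"
  define c where "c = c1 + c2"
  have c1: "3 \<le> c1" using l1 by (simp add: c1_def)
  have c2: "1 \<le> c2" using B l2 by (simp add: c2_def)
  have c: "1 \<le> c" "c1 \<le> c" "c2 \<le> c" using c1 c2 by (auto simp: c_def)
  define X where "X = 8 * (15 * real M * c) ^ (2 * M + 1)"
  have Mc: "1 \<le> 15 * real M * c" using M c mult_mono[of 1 "15 * real M" 1 c] by simp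
  have X: "1 \<le> X" using one_le_power[OF Mc, of "2 * M + 1"] unfolding X_def by linarith
  define e0 where "e0 = Min {exp (- 1), lo * D, 1 / X}"
  have e0: "0 < e0" "e0 \<le> exp (- 1)" "e0 \<le> lo * D" "e0 \<le> 1 / X"
    using lo D X by (auto simp: e0_def)
  have "e0 < 1" using e0(2) by (smt (verit) exp_less_one_iff)
  moreover have "\<exists>N J \<rho>. 0 < \<rho> \<and> \<rho> < 1 \<and> hi ^ N \<le> \<rho> \<and> 1 \<le> 2 ^ J * (lo * \<rho>) \<and>
     8 * ((real N + 1) * (2 * real N + 1)) ^ M * (52 * B * (real J + 1) + 1) \<le> \<rho> powr - \<epsilon> \<and>
     1 / (lo * \<rho>) \<le> D * exp (20 * real M * (1 / \<epsilon>) * ln (1 / \<epsilon>))" if \<epsilon>: "\<epsilon> \<in> {0<..e0}" for \<epsilon>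
  proof -
    define E where "E = 1 / \<epsilon>"
    have E0: "0 < E" using \<epsilon> by (simp add: E_def)
    have "\<epsilon> \<le> inverse (exp 1)" using \<epsilon> e0(2) by (simp flip: exp_minus)
    then have "exp 1 \<le> E" using \<epsilon> by (simp add: E_def field_simps)
    then have lnE: "1 \<le> ln E" using E0 by (simp add: ln_ge_iff)
    have lnE': "ln E \<le> E" using ln_le_minus_one[OF E0] by linarith
    have E1: "1 \<le> E" using lnE lnE' by linarith
    define l where "l = 15 * real M * E * ln E"
    have "1 \<le> 15 * real M * E" using M E1 mult_mono[of 1 "15 * real M" 1 E] by simp
    then have l1': "1 \<le> l" using lnE mult_mono[of 1 "15 * real M * E" 1 "ln E"]
      unfolding l_def by (smt (verit))
    have lE: "l \<le> 15 * real M * E\<^sup>2"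
      using lnE' E0 by (simp add: l_def power2_eq_square mult_left_mono)
    define \<rho> where "\<rho> = exp (- l)"
    define N where "N = nat \<lceil>l / l1\<rceil>"
    define J where "J = nat \<lceil>(l + l2) / ln 2\<rceil>"
    have N: "l / l1 \<le> real N" "real N \<le> l / l1 + 1"
      using l1 l1' of_nat_ceiling[of "l / l1"] by (simp_all add: N_def)
    have J: "(l + l2) / ln 2 \<le> real J" "real J \<le> (l + l2) / ln 2 + 1"
      using l2 l1' of_nat_ceiling[of "(l + l2) / ln 2"] by (simp_all add: J_def)
    have "hi ^ N = exp (real N * - l1)"
      using hi by (simp add: l1_def ln_div exp_of_nat_mult)
    also have "\<dots> \<le> \<rho>" using N(1) l1 by (simp add: \<rho>_def field_simps)
    finally have g1: "hi ^ N \<le> \<rho>" .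
    have "lo * \<rho> = exp (- l - l2)" using lo by (simp add: l2_def \<rho>_def ln_div exp_diff exp_minus divide_inverse exp_add)
    then have lor: "2 ^ J * (lo * \<rho>) = exp (real J * ln 2 + (- l - l2))"
      by (simp add: exp_of_nat_mult exp_add exp_diff)
    have g2: "1 \<le> 2 ^ J * (lo * \<rho>)" unfolding lor using J(1) by (simp add: field_simps)
    have cl: "1 \<le> c * l" using c l1' mult_mono[of 1 c 1 l] by simp
    have N1: "2 * real N + 1 \<le> c * l"
    proof -
      have "2 * real N + 1 \<le> 2 / l1 * l + 3 * 1" using N(2) by simp
      also have "\<dots> \<le> 2 / l1 * l + 3 * l" using l1' by simp
      also have "\<dots> = c1 * l" by (simp add: c1_def algebra_simps)
      also have "\<dots> \<le> c * l" using c l1' by (intro mult_right_mono) auto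
      finally show ?thesis .
    qed
    have J1: "52 * B * (real J + 1) + 1 \<le> c * l"
    proof -
      have "l2 * 1 \<le> l2 * l" using l2 l1' by (intro mult_left_mono) auto
      then have "(l + l2) / ln 2 \<le> ((1 + l2) * l) / ln 2" by (intro divide_right_mono) (auto simp: algebra_simps)
      then have "real J + 1 \<le> ((1 + l2) / ln 2 + 2) * l" using J(2) l1' by (simp add: algebra_simps)
      then have "52 * B * (real J + 1) \<le> 52 * B * (((1 + l2) / ln 2 + 2) * l)" using B by (intro mult_left_mono) auto
      then have "52 * B * (real J + 1) + 1 \<le> c2 * l" using l1' by (simp add: c2_def algebra_simps)
      also have "\<dots> \<le> c * l" using c l1' by (intro mult_right_mono) auto
      finally show ?thesis .
    qed
    have "8 * ((real N + 1) * (2 * real N + 1)) ^ M * (52 * B * (real J + 1) + 1)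
        \<le> 8 * ((c * l) * (c * l)) ^ M * (c * l)"
      using N1 J1 B cl by (intro mult_mono power_mono order_refl) auto
    also have "\<dots> = 8 * (c * l) ^ (2 * M + 1)"
      by (simp add: power_mult power2_eq_square flip: mult.assoc)
    also have "\<dots> \<le> 8 * (15 * real M * c * E\<^sup>2) ^ (2 * M + 1)"
      using lE cl c mult_left_mono[OF lE, of c] by (intro mult_left_mono power_mono) (auto simp: algebra_simps)
    also have "\<dots> = X * E ^ (4 * M + 2)"
    proof -
      have "(E\<^sup>2) ^ (2 * M + 1) = E ^ (4 * M + 2)" unfolding power_mult[symmetric] by simp
      then show ?thesis unfolding X_def power_mult_distrib by simp
    qed
    also have "\<dots> \<le> E * E ^ (4 * M + 2)"
    proof (rule mult_right_mono)
      have "\<epsilon> \<le> 1 / X" using \<epsilon> e0(4) by simp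
      then have "\<epsilon> * X \<le> 1" using X by (simp add: field_simps)
      then show "X \<le> E" using \<epsilon> by (simp add: E_def field_simps)
    qed (use E0 in simp)
    also have "\<dots> = E ^ (4 * M + 3)" by (simp add: numeral_3_eq_3)
    also have "\<dots> \<le> E ^ (15 * M)" using E1 M by (intro power_increasing) auto
    also have "\<dots> = \<rho> powr - \<epsilon>"
    proof -
      have "E ^ (15 * M) = exp (real (15 * M) * ln E)" using E0 by (simp only: exp_of_nat_mult exp_ln)
      also have "real (15 * M) * ln E = - \<epsilon> * - l" using \<epsilon> by (simp add: l_def E_def)
      finally show ?thesis by (simp add: \<rho>_def powr_def)
    qed
    finally have g3: "8 * ((real N + 1) * (2 * real N + 1)) ^ M * (52 * B * (real J + 1) + 1) \<le> \<rho> powr - \<epsilon>" .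
    have g4: "1 / (lo * \<rho>) \<le> D * exp (20 * real M * E * ln E)"
    proof -
      have "ln E \<le> 5 * real M * E * ln E"
        using lnE M E1 mult_mono[of 1 "5 * real M" 1 E] mult_right_mono[of 1 "5 * real M * E" "ln E"] by simp
      then have "exp (ln E) \<le> exp (5 * real M * E * ln E)" by simp
      then have "E \<le> exp (5 * real M * E * ln E)" using E0 by simp
      moreover have "1 \<le> lo * D * E" using \<epsilon> e0(3) by (simp add: E_def field_simps)
      moreover have "lo * D * E \<le> lo * D * exp (5 * real M * E * ln E)"
        using calculation(1) lo D by (intro mult_left_mono) auto
      ultimately have "1 \<le> lo * D * exp (5 * real M * E * ln E)" by linarith
      then have "1 * exp l \<le> lo * D * exp (5 * real M * E * ln E) * exp l" by (intro mult_right_mono) auto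
      also have "\<dots> = lo * (D * exp (20 * real M * E * ln E))"
        by (simp add: l_def flip: exp_add)
      finally show ?thesis using lo by (simp add: \<rho>_def exp_minus field_simps)
    qed
    have "0 < \<rho>" "\<rho> < 1" using l1' by (simp_all add: \<rho>_def)
    then show ?thesis using g1 g2 g3 g4 unfolding E_def by blast
  qed
  ultimately show ?thesis using e0(1) by blast
qed

text \<open>Among the words stopped at \<open>\<rho>\<^sub>0\<close> take the heaviest class with a common linear part, and choose an initial direction
along whose orbit the overlap stays bounded by \<open>L\<close> in the mean. At stage \<open>i\<close> the Moran construction uses a
subset of the class whose projections in the \<open>i\<close>-th direction of the orbit are separated.\<close>

lemma exists_graph_at_scale:
  assumes M: "1 \<le> M" and ifs: "is_ifs M r A z" and f: "f = ifs_map r A z" and att: "is_attractor M f H"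
    and D: "0 < diameter H" and sim: "is_similarity_dimension M r 1" and ahl: "ahlfors_regular_1 a b H"
    and \<rho>\<^sub>0: "0 < \<rho>\<^sub>0" "\<rho>\<^sub>0 < 1" and N: "r M ^ N \<le> \<rho>\<^sub>0" and J: "1 \<le> 2 ^ J * (r 1 * \<rho>\<^sub>0)"
    and big: "8 * ((real N + 1) * (2 * real N + 1)) ^ M * (52 * (6 * b / a + 3) * (real J + 1) + 1) \<le> \<rho>\<^sub>0 powr - \<epsilon>"
    and \<epsilon>: "0 < \<epsilon>"
  shows "\<exists>\<Gamma> \<theta> T g. is_lipschitz_graph \<Gamma> \<theta> T g \<and> ereal (1 - \<epsilon>) \<le> hausdorff_dim (H \<inter> \<Gamma>) \<and>
    lip_const g T \<le> 1 / (r 1 * \<rho>\<^sub>0)"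
proof -
  define D where "D = diameter H"
  define B where "B = 6 * b / a + 3"
  have D0: "0 < D" using D by (simp add: D_def)
  have B0: "0 \<le> B" using ahl by (simp add: B_def ahlfors_regular_1_def)
  have H: "compact H" "H \<noteq> {}" "H = (\<Union>k\<in>{1..M}. f k ` H)" using att unfolding is_attractor_def by blast+
  have r: "0 < r k" "r k < 1" "orthogonal_matrix (A k)" "r 1 \<le> r k" "r k \<le> r M" if "k \<in> {1..M}" for k
    using ifs that M unfolding is_ifs_def by auto
  have "(\<Sum>k\<in>{1..M}. r k powr 1) = (\<Sum>k\<in>{1..M}. r k)"
    using r(1) by (intro sum.cong refl powr_one) (auto intro: less_imp_le)
  then have rsum: "(\<Sum>k\<in>{1..M}. r k) = 1" using sim by (simp add: is_similarity_dimension_def)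
  have r1: "0 < r 1" "r 1 < 1" using r[of 1] M by auto
  have "\<exists>\<alpha> s. motion (r k) \<alpha> s (f k)" if "k \<in> {1..M}" for k
    unfolding f using r[OF that] by (intro motion_ifs_map)
  then obtain \<alpha>' s' where mot: "\<And>k. k \<in> {1..M} \<Longrightarrow> motion (r k) (\<alpha>' k) (s' k) (f k)" by metis
  have "r 1 * \<rho>\<^sub>0 < 1" using r1 \<rho>\<^sub>0 mult_strict_mono[of "r 1" 1 \<rho>\<^sub>0 1] by simp
  then have "\<exists>W. finite W \<and> (\<forall>w\<in>W. set w \<subseteq> {1..M} \<and> length w \<le> N) \<and>
     (\<forall>w\<in>W. r 1 * \<rho>\<^sub>0 < word_ratio r w \<and> word_ratio r w \<le> \<rho>\<^sub>0) \<and>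
     (\<Sum>w\<in>W. word_ratio r w) = 1 \<and> H = (\<Union>w\<in>W. word_map f w ` H)"
    using r by (intro exists_stopping_words[OF _ r1(1) rsum H(3) N]) auto
  then obtain W where W0: "finite W \<and> (\<forall>w\<in>W. set w \<subseteq> {1..M} \<and> length w \<le> N) \<and>
     (\<forall>w\<in>W. r 1 * \<rho>\<^sub>0 < word_ratio r w \<and> word_ratio r w \<le> \<rho>\<^sub>0) \<and>
     (\<Sum>w\<in>W. word_ratio r w) = 1 \<and> H = (\<Union>w\<in>W. word_map f w ` H)" ..
  have W: "finite W" "\<And>w. w \<in> W \<Longrightarrow> set w \<subseteq> {1..M} \<and> length w \<le> N"
    "\<And>w. w \<in> W \<Longrightarrow> r 1 * \<rho>\<^sub>0 < word_ratio r w \<and> word_ratio r w \<le> \<rho>\<^sub>0"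
    "(\<Sum>w\<in>W. word_ratio r w) = 1" "H = (\<Union>w\<in>W. word_map f w ` H)"
    by (rule conjunct1[OF W0], rule bspec[OF conjunct1[OF conjunct2[OF W0]]], assumption,
      rule bspec[OF conjunct1[OF conjunct2[OF conjunct2[OF W0]]]], assumption,
      rule conjunct1[OF conjunct2[OF conjunct2[OF conjunct2[OF W0]]]],
      rule conjunct2[OF conjunct2[OF conjunct2[OF conjunct2[OF W0]]]])
  obtain C \<rho> \<alpha> s where C: "C \<subseteq> W" "C \<noteq> {}"
    "\<And>w. w \<in> C \<Longrightarrow> word_ratio r w = \<rho> \<and> motion \<rho> \<alpha> s (word_map f w)"
    "1 \<le> 2 * ((real N + 1) * (2 * real N + 1)) ^ M * (real (card C) * \<rho>)"
    using exists_class_of_equal_motions[OF mot W(1,2,4)] by metis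
  have finC: "finite C" using C(1) W(1) by (rule finite_subset)
  have cC: "0 < real (card C)" using finC C(2) by (simp add: card_gt_0_iff)
  obtain w1 where w1: "w1 \<in> C" using C(2) by blast
  have \<rho>_range: "r 1 * \<rho>\<^sub>0 < \<rho>" "\<rho> \<le> \<rho>\<^sub>0" using C(1,3) W(3) w1 by blast+
  have \<rho>0: "0 < \<rho>" "\<rho> < 1" using \<rho>_range \<rho>\<^sub>0 mult_pos_pos[OF r1(1) \<rho>\<^sub>0(1)] by linarith+
  have s: "s = 1 \<or> s = -1" using C(3)[OF w1] by (auto simp: motion_def)
  have Wmot: "motion (word_ratio r w) (word_angle \<alpha>' s' w) (word_sign s' w) (word_map f w)" if "w \<in> W" for w
    using mot W(2)[OF that] by (intro motion_word_map[of M]) auto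
  have dW: "dist (word_map f w x) (word_map f w y) = word_ratio r w * dist x y" if "w \<in> W" for w x y
    by (rule motion_dist[OF Wmot[OF that]])
  have fH: "word_map f w x \<in> H" if "w \<in> W" "x \<in> H" for w x
  proof -
    have "word_map f w x \<in> (\<Union>w\<in>W. word_map f w ` H)" using that by blast
    then show ?thesis unfolding W(5)[symmetric] .
  qed
  have dH: "dist x y \<le> D" if "x \<in> H" "y \<in> H" for x y
    unfolding D_def using that H(1) by (intro diameter_bounded_bound compact_imp_bounded)
  obtain h where h: "h \<in> H" using H(2) by blast
  \<comment> \<open>Separation by \<open>3 * \<rho> * D\<close> of one reference point per piece separates the pieces themselves by \<open>\<rho> * D\<close>,
    as every piece stays within \<open>\<rho> * D\<close> of its reference point.\<close>
  define p where "p w = word_map f w h" for w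
  have pH: "p w \<in> H" if "w \<in> C" for w using fH C(1) h that by (auto simp: p_def)
  have count: "real (card {w' \<in> C. dist (p w') (p w) \<le> t * D}) \<le> B * t / \<rho>" if "w \<in> C" "\<rho> \<le> t" for w t
    unfolding p_def D_def B_def
    using that C(1,3) h dW Wmot
    by (intro card_pieces_near_point[OF ahl H(1,2) D W(1,5,4)]) (auto simp: motion_def)
  define F where "F = overlap_average C p (3 * \<rho> * D)"
  have \<eta>: "0 < 3 * \<rho> * D" using \<rho>0 D0 by simp
  define T where "T = (\<lambda>\<theta>. real_of_int s * (\<theta> - \<alpha>))"
  define L where "L = 52 * B * (real J + 1) + 1"
  have L0: "0 < L" using B0 by (simp add: L_def add_nonneg_pos)
  have J': "1 \<le> 2 ^ J * \<rho>" 
    using \<rho>_range(1) by (intro order_trans[OF J] mult_left_mono) auto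
  obtain Q :: nat where Q: "1 \<le> real Q * \<rho>" using reals_Archimedean3[OF \<rho>0(1)] less_imp_le by blast
  have Q0: "0 < Q" using Q by (cases Q) auto
  have "\<exists>\<theta>. \<forall>k. (\<Sum>i<k. F ((T ^^ i) \<theta>)) \<le> real k * L"
  proof (rule exists_orbit_with_bounded_averages[where s = "real_of_int s" and \<alpha> = \<alpha> and Q = Q and m = "52 * B * (real J + 1)"])
    show "continuous_on UNIV F" unfolding F_def by (rule continuous_overlap_average[OF \<eta>])
    show "0 \<le> F \<theta>" for \<theta> unfolding F_def by (rule overlap_average_nonneg)
    show "F (\<theta> + pi) = F \<theta>" for \<theta> unfolding F_def by (rule overlap_average_periodic)
    show "(\<Sum>j<Q. F (c + \<sigma> * pi * real j / real Q)) \<le> real Q * (52 * B * (real J + 1))"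
      if "\<sigma> = 1 \<or> \<sigma> = -1" for c \<sigma>
      unfolding F_def using dH pH that
      by (intro grid_sum_overlap_average_le[OF finC C(2) \<rho>0(1) D0 B0 _ count J' _ Q]) auto
  qed (use s Q0 in \<open>auto simp: T_def L_def\<close>)
  then obtain \<theta> where \<theta>: "\<And>k. (\<Sum>i<k. F ((T ^^ i) \<theta>)) \<le> real k * L" by blast
  have Fpos: "0 < F \<theta>'" for \<theta>' unfolding F_def by (rule overlap_average_pos[OF finC C(2) \<eta>])
  have "\<exists>S\<subseteq>C. (\<forall>w\<in>S. \<forall>w'\<in>S. w \<noteq> w' \<longrightarrow> 3 * \<rho> * D < \<bar>angle_proj ((T ^^ i) \<theta>) (p w - p w')\<bar>) \<and>
      real (card C) \<le> 4 * F ((T ^^ i) \<theta>) * real (card S)" for i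
    unfolding F_def by (rule exists_separated_subset[OF finC C(2) \<eta>])
  then obtain S where S: "\<And>i. S i \<subseteq> C"
    "\<And>i w w'. \<lbrakk>w \<in> S i; w' \<in> S i; w \<noteq> w'\<rbrakk> \<Longrightarrow> 3 * \<rho> * D < \<bar>angle_proj ((T ^^ i) \<theta>) (p w - p w')\<bar>"
    "\<And>i. real (card C) \<le> 4 * F ((T ^^ i) \<theta>) * real (card (S i))"
    by metis
  interpret moran_construction S "word_map f" H "\<lambda>i. angle_proj ((T ^^ i) \<theta>)" \<rho> D
  proof
    show "finite (S i)" for i using S(1) finC by (rule finite_subset)
    show "S i \<noteq> {}" for i using S(3)[of i] cC by auto
    show "compact H" "H \<noteq> {}" by (fact H(1), fact H(2))
    show "dist x y \<le> D" if "x \<in> H" "y \<in> H" for x y using dH that .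
    show "word_map f w ` H \<subseteq> H" if "w \<in> S i" for w i using fH S(1) C(1) that by blast
    show dist: "dist (word_map f w x) (word_map f w y) = \<rho> * dist x y" if "w \<in> S i" for w i x y
      using dW[of w x y] C(1,3) S(1)[of i] that by auto
    show "angle_proj ((T ^^ i) \<theta>) (word_map f w x) - angle_proj ((T ^^ i) \<theta>) (word_map f w y) =
        \<rho> * (angle_proj ((T ^^ Suc i) \<theta>) x - angle_proj ((T ^^ Suc i) \<theta>) y)" if "w \<in> S i" for w i x y
    proof -
      have "motion \<rho> \<alpha> s (word_map f w)" using C(3) S(1)[of i] that by blast
      then show ?thesis by (simp add: motion_def T_def)
    qed
    show "\<rho> * D \<le> \<bar>angle_proj ((T ^^ i) \<theta>) (word_map f w x) - angle_proj ((T ^^ i) \<theta>) (word_map f w' y)\<bar>"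
      if w: "w \<in> S i" "w' \<in> S i" "w \<noteq> w'" and xy: "x \<in> H" "y \<in> H" for w w' i x y
    proof -
      have close: "\<bar>angle_proj ((T ^^ i) \<theta>) (word_map f v u) - angle_proj ((T ^^ i) \<theta>) (p v)\<bar> \<le> \<rho> * D"
        if "v \<in> S i" "u \<in> H" for u v
      proof -
        have "\<bar>angle_proj ((T ^^ i) \<theta>) (word_map f v u - p v)\<bar> \<le> dist (word_map f v u) (p v)"
          unfolding dist_norm by (rule abs_angle_proj_le)
        also have "\<dots> \<le> \<rho> * D"
          unfolding p_def dist[OF that(1)] using \<rho>0 dH[OF that(2) h] by (intro mult_left_mono) auto
        finally show ?thesis by (simp add: angle_proj_diff)
      qed
      show ?thesis
        using S(2)[OF w] close[OF w(1) xy(1)] close[OF w(2) xy(2)] unfolding angle_proj_diff by linarith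
    qed
    show "\<bar>angle_proj ((T ^^ 0) \<theta>) x - angle_proj ((T ^^ 0) \<theta>) y\<bar> \<le> dist x y" for x y
      unfolding angle_proj_diff[symmetric] dist_norm by (rule abs_angle_proj_le)
  qed (use \<rho>0 D0 in auto)
  \<comment> \<open>In geometric mean a stage offers at least \<open>card C / (4 * L)\<close> maps.\<close>
  have gain: "1 \<le> real (card C) / (4 * L) * \<rho> powr (1 - \<epsilon>)"
  proof -
    define X where "X = 2 * ((real N + 1) * (2 * real N + 1)) ^ M"
    have X0: "0 < X" by (simp add: X_def add_pos_nonneg)
    have "4 * L * X \<le> \<rho>\<^sub>0 powr - \<epsilon>" using big by (simp add: X_def L_def B_def algebra_simps)
    also have "\<dots> \<le> \<rho> powr - \<epsilon>" using \<rho>0 \<rho>_range \<epsilon> by (intro powr_mono2') auto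
    finally have "4 * L * X \<le> \<rho> powr - \<epsilon>" .
    also have "\<dots> = \<rho> powr - \<epsilon> * 1" by simp
    also have "\<dots> \<le> \<rho> powr - \<epsilon> * (X * (real (card C) * \<rho>))"
      using C(4) by (intro mult_left_mono) (auto simp: X_def)
    also have "\<dots> = X * (real (card C) * (\<rho> powr - \<epsilon> * \<rho> powr 1))" using \<rho>0 by simp
    also have "\<rho> powr - \<epsilon> * \<rho> powr 1 = \<rho> powr (1 - \<epsilon>)"
      unfolding powr_add[symmetric] by simp
    finally have "X * (4 * L) \<le> X * (real (card C) * \<rho> powr (1 - \<epsilon>))" by (simp add: algebra_simps)
    then have "4 * L \<le> real (card C) * \<rho> powr (1 - \<epsilon>)" using X0 by simp
    then show ?thesis using L0 by (simp add: field_simps)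
  qed
  have growth: "1 \<le> real (card (addresses 0 k)) * (\<rho> powr (1 - \<epsilon>)) ^ k" for k
  proof -
    have "real (card C) ^ k \<le> (\<Prod>i<k. 4 * F ((T ^^ i) \<theta>) * real (card (S i)))"
      using prod_mono[of "{..<k}" "\<lambda>_. real (card C)" "\<lambda>i. 4 * F ((T ^^ i) \<theta>) * real (card (S i))"] S(3) by simp
    also have "\<dots> = 4 ^ k * (\<Prod>i<k. F ((T ^^ i) \<theta>)) * real (card (addresses 0 k))"
      by (simp add: prod.distrib card_addresses)
    also have "\<dots> \<le> 4 ^ k * L ^ k * real (card (addresses 0 k))"
      using prod_le_power_of_average_le[of "\<lambda>i. F ((T ^^ i) \<theta>)" L k] Fpos L0 \<theta>
      by (intro mult_right_mono mult_left_mono) (auto intro: less_imp_le)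
    finally have "(real (card C) / (4 * L)) ^ k \<le> real (card (addresses 0 k))"
      using L0 by (simp add: power_divide power_mult_distrib field_simps)
    then have "(real (card C) / (4 * L)) ^ k * (\<rho> powr (1 - \<epsilon>)) ^ k
        \<le> real (card (addresses 0 k)) * (\<rho> powr (1 - \<epsilon>)) ^ k"
      by (intro mult_right_mono) auto
    moreover have "1 \<le> (real (card C) / (4 * L) * \<rho> powr (1 - \<epsilon>)) ^ k" using gain by (rule one_le_power)
    ultimately show ?thesis unfolding power_mult_distrib by linarith
  qed
  have "ereal (1 - \<epsilon>) \<le> hausdorff_dim (H \<inter> limit_set)"
    using hausdorff_dim_limit_set[OF growth] limit_set_subset by (simp add: Int_absorb1)
  moreover have "\<exists>U g. is_lipschitz_graph limit_set \<theta> U g \<and> lip_const g U \<le> 1 / \<rho>"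
    using \<rho>0 limit_set_cone by (intro lipschitz_graph_of_cone_condition) auto
  moreover have "1 / \<rho> \<le> 1 / (r 1 * \<rho>\<^sub>0)"
    using \<rho>_range(1) \<rho>\<^sub>0 r1 by (intro frac_le) auto
  ultimately show ?thesis by (meson order_trans)
qed

definition graph_bound_holds ::
  "nat \<Rightarrow> (nat \<Rightarrow> real) \<Rightarrow> (real^2) set \<Rightarrow> (real^2) set \<Rightarrow> real \<Rightarrow> bool" where
  "graph_bound_holds M r H K \<epsilon> \<longleftrightarrow> (\<exists>\<Gamma> \<theta> T g.
     is_lipschitz_graph \<Gamma> \<theta> T g \<and> hausdorff_dim (H \<inter> \<Gamma>) \<ge> ereal (1 - \<epsilon>) \<and>
     lip_const g T \<le> diameter K / (\<Prod>k\<in>{1..M}. r k) * exp (20 * real M * (1 / \<epsilon>) * ln (1 / \<epsilon>)))"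

text \<open>The threshold depends only on the smallest and the largest ratio, on \<open>M\<close>, \<open>b/a\<close> and the diameter of \<open>K\<close>. It
is therefore read off from an arbitrary system with the prescribed data and serves for all the others.\<close>

lemma exists_uniform_threshold:
  "\<exists>e0. 0 < e0 \<and> e0 < 1 \<and> (\<forall>r A z H. is_ifs M r A z \<longrightarrow> is_attractor M (ifs_map r A z) H \<longrightarrow>
     0 < diameter H \<longrightarrow> is_similarity_dimension M r 1 \<longrightarrow> ahlfors_regular_1 a b H \<longrightarrow>
     map r [1..<Suc M] = rs \<longrightarrow> K = convex hull H \<longrightarrow> (\<forall>\<epsilon>\<in>{0<..e0}. graph_bound_holds M r H K \<epsilon>))"
proof (cases "\<exists>r A z H. is_ifs M r A z \<and> is_attractor M (ifs_map r A z) H \<and> 0 < diameter H \<and>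
     is_similarity_dimension M r 1 \<and> ahlfors_regular_1 a b H \<and> map r [1..<Suc M] = rs \<and> K = convex hull H")
  case False
  then show ?thesis by (intro exI[of _ "1/2"]) auto
next
  case True
  then obtain r0 A0 z0 H0 where 0: "is_ifs M r0 A0 z0" "is_attractor M (ifs_map r0 A0 z0) H0" "0 < diameter H0"
    "is_similarity_dimension M r0 1" "ahlfors_regular_1 a b H0" "map r0 [1..<Suc M] = rs" "K = convex hull H0" by blast
  have diam: "diameter K = diameter H" if "is_attractor M f H" "K = convex hull H" for f H
    using that diameter_convex_hull[of H] compact_imp_bounded[of H] by (simp add: is_attractor_def)
  have M: "1 \<le> M" using 0(4) by (cases M) (auto simp: is_similarity_dimension_def)
  have r0: "0 < r0 k" "r0 k < 1" if "k \<in> {1..M}" for k using 0(1) that by (auto simp: is_ifs_def)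
  have K: "0 < diameter K" using diam[OF 0(2,7)] 0(3) by simp
  have B: "0 \<le> 6 * b / a + 3" using 0(5) by (simp add: ahlfors_regular_1_def)
  obtain e0 where e0: "0 < e0" "e0 < 1" and par: "\<And>\<epsilon>. \<epsilon> \<in> {0<..e0} \<Longrightarrow> \<exists>N J \<rho>. 0 < \<rho> \<and> \<rho> < 1 \<and> r0 M ^ N \<le> \<rho> \<and>
     1 \<le> 2 ^ J * (r0 1 * \<rho>) \<and>
     8 * ((real N + 1) * (2 * real N + 1)) ^ M * (52 * (6 * b / a + 3) * (real J + 1) + 1) \<le> \<rho> powr - \<epsilon> \<and>
     1 / (r0 1 * \<rho>) \<le> diameter K * exp (20 * real M * (1 / \<epsilon>) * ln (1 / \<epsilon>))"
    using scale_parameters_exist[OF M _ _ _ _ B K, of "r0 1" "r0 M"] r0[of 1] r0[of M] M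
    by (auto simp: less_imp_le)
  have "graph_bound_holds M r H K \<epsilon>"
    if h: "is_ifs M r A z" "is_attractor M (ifs_map r A z) H" "0 < diameter H" "is_similarity_dimension M r 1"
      "ahlfors_regular_1 a b H" "map r [1..<Suc M] = rs" "K = convex hull H" and \<epsilon>: "\<epsilon> \<in> {0<..e0}" for r A z H \<epsilon>
  proof -
    have eq: "r k = r0 k" if "k \<in> {1..M}" for k
    proof -
      have "map r [1..<Suc M] = map r0 [1..<Suc M]" using h(6) 0(6) by simp
      moreover have "k \<in> set [1..<Suc M]" using that by auto
      ultimately show ?thesis unfolding map_eq_conv by blast
    qed
    obtain N J \<rho> where p: "0 < \<rho>" "\<rho> < 1" "r M ^ N \<le> \<rho>" "1 \<le> 2 ^ J * (r 1 * \<rho>)"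
      "8 * ((real N + 1) * (2 * real N + 1)) ^ M * (52 * (6 * b / a + 3) * (real J + 1) + 1) \<le> \<rho> powr - \<epsilon>"
      "1 / (r 1 * \<rho>) \<le> diameter K * exp (20 * real M * (1 / \<epsilon>) * ln (1 / \<epsilon>))"
      using par[OF \<epsilon>] eq[of 1] eq[of M] M by auto
    have prod: "0 < (\<Prod>k\<in>{1..M}. r k)" "(\<Prod>k\<in>{1..M}. r k) \<le> 1"
      using r0 eq by (auto intro!: prod_pos) (intro prod_le_1, auto simp: less_imp_le)
    have "diameter K * 1 \<le> diameter K * (1 / (\<Prod>k\<in>{1..M}. r k))"
      using prod K by (intro mult_left_mono) (auto simp: field_simps)
    then have "diameter K * exp (20 * real M * (1 / \<epsilon>) * ln (1 / \<epsilon>))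
        \<le> diameter K / (\<Prod>k\<in>{1..M}. r k) * exp (20 * real M * (1 / \<epsilon>) * ln (1 / \<epsilon>))"
      by (intro mult_right_mono) auto
    then have "1 / (r 1 * \<rho>) \<le> diameter K / (\<Prod>k\<in>{1..M}. r k) * exp (20 * real M * (1 / \<epsilon>) * ln (1 / \<epsilon>))"
      using p(6) by linarith
    then show ?thesis
      using exists_graph_at_scale[OF M h(1) refl h(2-5) p(1-5)] \<epsilon> unfolding graph_bound_holds_def
      by (meson greaterThanAtMost_iff order_trans)
  qed
  then show ?thesis using e0 by blast
qed

theorem theorem7p11:
  "\<exists>\<epsilon>\<^sub>0 :: real list \<Rightarrow> nat \<Rightarrow> real \<Rightarrow> real \<Rightarrow> nat \<Rightarrow> (real^2) set \<Rightarrow> real.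
     \<forall>(M::nat) (r :: nat \<Rightarrow> real) (A :: nat \<Rightarrow> real^2^2) (z :: nat \<Rightarrow> real^2)
       (f :: nat \<Rightarrow> real^2 \<Rightarrow> real^2) (H :: (real^2) set) (K :: (real^2) set)
       (\<nu>::real) (a::real) (b::real) (\<tau>::nat) (e0::real).
       is_ifs M r A z \<longrightarrow>
       f = ifs_map r A z \<longrightarrow>
       is_attractor M f H \<longrightarrow>
       nondegenerate \<nu> H \<longrightarrow>
       open_set_condition M f \<longrightarrow>
       is_similarity_dimension M r 1 \<longrightarrow>
       ahlfors_regular_1 a b H \<longrightarrow>
       K = convex hull H \<longrightarrow>
       \<tau> = overlapping_index M f K \<longrightarrow>
       e0 = \<epsilon>\<^sub>0 (map r [1..<Suc M]) M a b \<tau> K \<longrightarrow>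
       e0 \<in> {0<..<1} \<and>
       (\<forall>\<epsilon>\<in>{0<..e0}. \<exists>\<Gamma> \<theta> T g.
          is_lipschitz_graph \<Gamma> \<theta> T g \<and>
          hausdorff_dim (H \<inter> \<Gamma>) \<ge> ereal (1 - \<epsilon>) \<and>
          lip_const g T \<le> diameter K / (\<Prod>k\<in>{1..M}. r k) * max (1 / \<nu>) 1
            * exp (20 * real M * (1 / \<epsilon>) * ln (1 / \<epsilon>)))"
proof -
  define good where "good rs M a b K e0 \<longleftrightarrow> 0 < e0 \<and> e0 < 1 \<and>
    (\<forall>r A z H. is_ifs M r A z \<longrightarrow> is_attractor M (ifs_map r A z) H \<longrightarrow>
     0 < diameter H \<longrightarrow> is_similarity_dimension M r 1 \<longrightarrow> ahlfors_regular_1 a b H \<longrightarrow>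
     map r [1..<Suc M] = rs \<longrightarrow> K = convex hull H \<longrightarrow> (\<forall>\<epsilon>\<in>{0<..e0}. graph_bound_holds M r H K \<epsilon>))"
    for rs M a b K e0
  define E where "E rs M a b K = (SOME e0. good rs M a b K e0)" for rs M a b K
  have E: "good rs M a b K (E rs M a b K)" for rs M a b K
    unfolding E_def by (rule someI_ex) (unfold good_def, rule exists_uniform_threshold)
  show ?thesis
  proof (intro exI[of _ "\<lambda>rs M a b \<tau> K. E rs M a b K"] allI impI conjI ballI)
    fix M r A z f H K \<nu> a b \<tau> e0
    assume h: "is_ifs M r A z" "f = ifs_map r A z" "is_attractor M f H" "nondegenerate \<nu> H"
      "is_similarity_dimension M r 1" "ahlfors_regular_1 a b H" "K = convex hull H"
      and e0: "e0 = E (map r [1..<Suc M]) M a b K"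
    have good: "good (map r [1..<Suc M]) M a b K e0" using E e0 by simp
    then show "e0 \<in> {0<..<1}" by (simp add: good_def)
    fix \<epsilon> assume \<epsilon>: "\<epsilon> \<in> {0<..e0}"
    have H: "compact H" "H \<noteq> {}" using h(3) by (auto simp: is_attractor_def)
    have D: "0 < diameter H" by (rule nondegenerate_diameter_pos[OF h(4) H])
    have "graph_bound_holds M r H K \<epsilon>" using good h D \<epsilon> unfolding good_def by blast
    then obtain \<Gamma> \<theta> T g where G: "is_lipschitz_graph \<Gamma> \<theta> T g" "hausdorff_dim (H \<inter> \<Gamma>) \<ge> ereal (1 - \<epsilon>)"
      "lip_const g T \<le> diameter K / (\<Prod>k\<in>{1..M}. r k) * exp (20 * real M * (1 / \<epsilon>) * ln (1 / \<epsilon>))"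
      by (auto simp: graph_bound_holds_def)
    have "0 \<le> diameter K / (\<Prod>k\<in>{1..M}. r k)"
    proof (intro divide_nonneg_nonneg prod_nonneg)
      show "0 \<le> diameter K"
        using D diameter_convex_hull[OF compact_imp_bounded[OF H(1)] H(2)] h(7) by simp
      show "0 \<le> r k" if "k \<in> {1..M}" for k using h(1) that by (auto simp: is_ifs_def less_imp_le)
    qed
    then have "diameter K / (\<Prod>k\<in>{1..M}. r k) * 1 \<le> diameter K / (\<Prod>k\<in>{1..M}. r k) * max (1 / \<nu>) 1"
      by (intro mult_left_mono) auto
    then have "diameter K / (\<Prod>k\<in>{1..M}. r k) * exp (20 * real M * (1 / \<epsilon>) * ln (1 / \<epsilon>))
        \<le> diameter K / (\<Prod>k\<in>{1..M}. r k) * max (1 / \<nu>) 1 * exp (20 * real M * (1 / \<epsilon>) * ln (1 / \<epsilon>))"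
      by (intro mult_right_mono) auto
    then show "\<exists>\<Gamma> \<theta> T g. is_lipschitz_graph \<Gamma> \<theta> T g \<and> hausdorff_dim (H \<inter> \<Gamma>) \<ge> ereal (1 - \<epsilon>) \<and>
        lip_const g T \<le> diameter K / (\<Prod>k\<in>{1..M}. r k) * max (1 / \<nu>) 1 * exp (20 * real M * (1 / \<epsilon>) * ln (1 / \<epsilon>))"
      using G by (meson order_trans)
  qed
qed

end
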